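(* Let $\bar g\in G^N(\mathbb{R}^d)$ and $T>0$. Consider Sobolev-regular ($H^1$) admissible curves $\xi:[0,T]\to G^N(\mathbb{R}^d)$ such that $\xi(0)=(1,0,\dots,0)$ and $\xi(T)=\bar g$, and let $a\in L^2([0,T],\mathbb{R}^d)$ be the admissible control that generates $\xi$. Then the following conditions are equivalent: (1) The admissible control $a$ minimizes the energy $J(a)=\frac12\int_0^T|a(t)|^2\,dt$ (among the controls whose curve starting at $(1,0,\dots,0)$ reaches $\bar g$ at time $T$). (2) The curve $\xi$ is a minimizer of the length $\ell(\xi)=\int_0^T|a(t)|\,dt$ (among the admissible curves on $[0,T]$ joining $(1,0,\dots,0)$ to $\bar g$), and its control fulfils $|a(t)|=c>0$ for almost every $t\in[0,T]$, with $c$ constant. (3) Consider the problem of finding the minimal time $\hat T$ such that there exists a Sobolev-regular admissible curve $\hat\xi:[0,\hat T]\to G^N(\mathbb{R}^d)$ with $\hat\xi(0)=(1,0,\dots,0)$ and $\hat\xi(\hat T)=\bar g$, whose control fulfils $|\hat a(t)|=1$ for almost every $t\in[0,\hat T]$. Then $\xi$ is a reparametrization of $\hat\xi$.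
   Context: Here $d,N\ge1$ are integers. Truncated tensor space: $T^N(\mathbb{R}^d)=\bigoplus_{k=0}^N(\mathbb{R}^d)^{\otimes k}$ with the truncated tensor product $(g\otimes h)^k=\sum_{i=0}^k g^i\otimes h^{k-i}$ for $0\le k\le N$ (terms of order $>N$ are dropped). Vectors of $\mathbb{R}^d$, in particular the canonical basis $e_1,\dots,e_d$, are viewed as elements of level $k=1$. Signature: for $x\in H^1([0,1],\mathbb{R}^d)$ (continuous paths with $x(0)=0$ and $\dot x\in L^2$), $S_N(x)_{0,1}=\big(1,\int_{0\le u\le 1}dx_u,\dots,\int_{0\le u_1\le\dots\le u_N\le 1}dx_{u_1}\otimes\dots\otimes dx_{u_N}\big)$. The space of signatures is $G^N(\mathbb{R}^d)=\{S_N(x)_{0,1}: x\in H^1([0,1],\mathbb{R}^d)\}\subset T^N(\mathbb{R}^d)$. Admissible curves: an admissible curve on $[0,T]$ generated by the control $a=(a_1,\dots,a_d)\in L^2([0,T],\mathbb{R}^d)$ is an $H^1$ curve $\xi:[0,T]\to G^N(\mathbb{R}^d)$ with $\dot\xi(s)=\sum_{i=1}^d a_i(s)\,U_i(\xi(s))$ for a.e. $s\in[0,T]$, where $U_i(\xi)=\xi\otimes e_i$. $|\cdot|$ is the Euclidean norm on $\mathbb{R}^d$. Reparametrization: a curve obtained by composing the given curve with a monotone increasing, smooth function from the new time interval onto the old one, i.e. in (3) $\xi=\hat\xi\circ\psi$ with such a $\psi:[0,T]\to[0,\hat T]$, $\psi(0)=0$, $\psi(T)=\hat T$.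
   Formalization: Assumes ḡ ≠ (1,0,…,0), since the constant curve gives (1) but not c>0 in (2). As reparametrizations need not keep constant speed (ψ(t)=t²), (3) is equivalent to (1) only together with |a| constant a.e.; (3) alone is shown to imply that ξ minimizes length. *)

theory Defs
  imports "HOL-Analysis.Analysis"
begin

text \<open>
  Tensors over \<open>real ^ 'd\<close> are given by their coordinates in the canonical bases: the
  coefficient of \<open>e_{i1} \<otimes> \<dots> \<otimes> e_{ik}\<close> is the value at the word \<open>[i1, \<dots>, ik]\<close>, and the level-\<open>k\<close>
  component is the restriction to the words of length \<open>k\<close>.  The space \<open>T^N\<close> consists of the
  functions that vanish on all words longer than \<open>N\<close>.
\<close>

type_synonym 'd tensor = "'d list \<Rightarrow> real"

definition truncated_tensors :: "nat \<Rightarrow> 'd tensor set" where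
  "truncated_tensors N = {g. \<forall>w. N < length w \<longrightarrow> g w = 0}"

definition tensor_mult :: "nat \<Rightarrow> 'd tensor \<Rightarrow> 'd tensor \<Rightarrow> 'd tensor" where
  "tensor_mult N g h =
     (\<lambda>w. if length w \<le> N then (\<Sum>i\<le>length w. g (take i w) * h (drop i w)) else 0)"

definition tensor_one :: "'d tensor" where
  "tensor_one = (\<lambda>w. if w = [] then 1 else 0)"

definition tensor_basis :: "'d \<Rightarrow> 'd tensor" where
  "tensor_basis i = (\<lambda>w. if w = [i] then 1 else 0)"

definition U :: "nat \<Rightarrow> 'd \<Rightarrow> 'd tensor \<Rightarrow> 'd tensor" where
  "U N i g = tensor_mult N g (tensor_basis i)"

definition L2_on :: "real \<Rightarrow> (real \<Rightarrow> 'a::euclidean_space) \<Rightarrow> bool" where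
  "L2_on T v \<longleftrightarrow> v \<in> borel_measurable (lebesgue_on {0..T}) \<and>
                integrable (lebesgue_on {0..T}) (\<lambda>t. (norm (v t))\<^sup>2)"

text \<open>
  \<open>H1_on T x v\<close>: the curve \<open>x\<close> is of class \<open>H^1\<close> on \<open>[0, T]\<close> with derivative \<open>v\<close>, i.e. \<open>x\<close> is
  absolutely continuous and \<open>v\<close> is an \<open>L^2\<close> representative of its (weak, equivalently almost
  everywhere) derivative.
\<close>

definition H1_on ::
  "real \<Rightarrow> (real \<Rightarrow> 'a::euclidean_space) \<Rightarrow> (real \<Rightarrow> 'a) \<Rightarrow> bool" where
  "H1_on T x v \<longleftrightarrow>
     L2_on T v \<and> (\<forall>t\<in>{0..T}. x t = x 0 + (LINT s|lebesgue_on {0..t}. v s))"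

definition ordered_simplex :: "nat \<Rightarrow> (nat \<Rightarrow> real) set" where
  "ordered_simplex k =
     {u. (\<forall>i<k. 0 \<le> u i \<and> u i \<le> 1) \<and> (\<forall>i j. i \<le> j \<and> j < k \<longrightarrow> u i \<le> u j)}"

text \<open>
  The truncated signature over \<open>[0, 1]\<close> of a path with derivative \<open>v\<close>, where \<open>dx_u = v u du\<close>.  On
  the empty word the integral is taken over a single point and equals \<open>1\<close>.
\<close>

definition signature :: "nat \<Rightarrow> (real \<Rightarrow> real ^ 'd) \<Rightarrow> 'd tensor" where
  "signature N v =
     (\<lambda>w. if length w \<le> N
          then (LINT u:ordered_simplex (length w)|Pi\<^sub>M {..<length w} (\<lambda>_. lebesgue_on {0..1}).
                  (\<Prod>j<length w. v (u j) $ (w ! j)))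
          else 0)"

definition signatures :: "nat \<Rightarrow> 'd::finite tensor set" where
  "signatures N = {signature N v | (x :: real \<Rightarrow> real ^ 'd) v. H1_on 1 x v \<and> x 0 = 0}"

lemma signatures_subset: "signatures N \<subseteq> truncated_tensors N"
  by (auto simp: signatures_def truncated_tensors_def signature_def)

definition admissible_curve ::
  "nat \<Rightarrow> real \<Rightarrow> (real \<Rightarrow> real ^ 'd::finite) \<Rightarrow> (real \<Rightarrow> 'd tensor) \<Rightarrow> bool" where
  "admissible_curve N T a \<xi> \<longleftrightarrow>
     L2_on T a \<and> (\<forall>s\<in>{0..T}. \<xi> s \<in> signatures N) \<and>
     (\<exists>D. (\<forall>w. H1_on T (\<lambda>s. \<xi> s w) (\<lambda>s. D s w)) \<and>
          (AE s in lebesgue_on {0..T}. D s = (\<lambda>w. \<Sum>i\<in>UNIV. a s $ i * U N i (\<xi> s) w)))"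

text \<open>Admissible curves on \<open>[0, T]\<close> that join the unit \<open>(1, 0, \<dots>, 0)\<close> to \<open>g\<close>.\<close>

definition joins ::
  "nat \<Rightarrow> real \<Rightarrow> 'd::finite tensor \<Rightarrow> (real \<Rightarrow> real ^ 'd) \<Rightarrow> (real \<Rightarrow> 'd tensor) \<Rightarrow> bool" where
  "joins N T g a \<xi> \<longleftrightarrow> admissible_curve N T a \<xi> \<and> \<xi> 0 = tensor_one \<and> \<xi> T = g"

definition energy :: "real \<Rightarrow> (real \<Rightarrow> real ^ 'd::finite) \<Rightarrow> real" where
  "energy T a = 1/2 * (LINT t|lebesgue_on {0..T}. (norm (a t))\<^sup>2)"

definition curve_length :: "real \<Rightarrow> (real \<Rightarrow> real ^ 'd::finite) \<Rightarrow> real" where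
  "curve_length T a = (LINT t|lebesgue_on {0..T}. norm (a t))"

definition constant_speed :: "real \<Rightarrow> (real \<Rightarrow> real ^ 'd::finite) \<Rightarrow> real \<Rightarrow> bool" where
  "constant_speed T a c \<longleftrightarrow> (AE t in lebesgue_on {0..T}. norm (a t) = c)"

definition minimizes_energy ::
  "nat \<Rightarrow> real \<Rightarrow> 'd::finite tensor \<Rightarrow> (real \<Rightarrow> real ^ 'd) \<Rightarrow> bool" where
  "minimizes_energy N T g a \<longleftrightarrow>
     (\<exists>\<xi>. joins N T g a \<xi>) \<and> (\<forall>b \<eta>. joins N T g b \<eta> \<longrightarrow> energy T a \<le> energy T b)"

text \<open>
  The length of an admissible curve is computed from its control, which the curve determines up to
  a null set (its level-one component has derivative \<open>a\<close>).
\<close>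

definition minimizes_length ::
  "nat \<Rightarrow> real \<Rightarrow> 'd::finite tensor \<Rightarrow> (real \<Rightarrow> real ^ 'd) \<Rightarrow> (real \<Rightarrow> 'd tensor) \<Rightarrow> bool" where
  "minimizes_length N T g a \<xi> \<longleftrightarrow>
     joins N T g a \<xi> \<and> (\<forall>b \<eta>. joins N T g b \<eta> \<longrightarrow> curve_length T a \<le> curve_length T b)"

definition minimizes_time ::
  "nat \<Rightarrow> 'd::finite tensor \<Rightarrow> real \<Rightarrow> (real \<Rightarrow> real ^ 'd) \<Rightarrow> (real \<Rightarrow> 'd tensor) \<Rightarrow> bool" where
  "minimizes_time N g T a \<xi> \<longleftrightarrow>
     0 \<le> T \<and> joins N T g a \<xi> \<and> constant_speed T a 1 \<and>
     (\<forall>S b \<eta>. 0 \<le> S \<and> joins N S g b \<eta> \<and> constant_speed S b 1 \<longrightarrow> T \<le> S)"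

text \<open>Derivatives of all orders on \<open>[0, T]\<close>, one-sided at the end points.\<close>

definition smooth_on_interval :: "real \<Rightarrow> (real \<Rightarrow> real) \<Rightarrow> bool" where
  "smooth_on_interval T \<psi> \<longleftrightarrow>
     (\<exists>D. D 0 = \<psi> \<and>
          (\<forall>k::nat. \<forall>t\<in>{0..T}. (D k has_real_derivative D (Suc k) t) (at t within {0..T})))"

definition reparametrization_of ::
  "real \<Rightarrow> (real \<Rightarrow> 'd tensor) \<Rightarrow> real \<Rightarrow> (real \<Rightarrow> 'd tensor) \<Rightarrow> bool" where
  "reparametrization_of T \<xi> S \<eta> \<longleftrightarrow>
     (\<exists>\<psi>. smooth_on_interval T \<psi> \<and> mono_on {0..T} \<psi> \<and> \<psi> ` {0..T} = {0..S} \<and>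
          \<psi> 0 = 0 \<and> \<psi> T = S \<and> (\<forall>t\<in>{0..T}. \<xi> t = \<eta> (\<psi> t)))"

definition reparametrizes_time_minimizer ::
  "nat \<Rightarrow> real \<Rightarrow> 'd::finite tensor \<Rightarrow> (real \<Rightarrow> 'd tensor) \<Rightarrow> bool" where
  "reparametrizes_time_minimizer N T g \<xi> \<longleftrightarrow>
     (\<exists>S b \<eta>. minimizes_time N g S b \<eta> \<and> reparametrization_of T \<xi> S \<eta>)"

end

theory Submission
  imports Defs
begin

text \<open>
  For a nonnegative integrable density \<open>\<rho>\<close> on \<open>[0, T]\<close> with primitive \<open>\<sigma>\<close>, the image of \<open>\<rho> dt\<close> under
  \<open>\<sigma>\<close> is Lebesgue measure on \<open>[0, \<sigma> T]\<close>.  Taking \<open>\<rho> = |b| / k\<close> for a control \<open>b\<close>, any right inverse \<open>\<tau>\<close>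
  of \<open>\<sigma>\<close> satisfies \<open>\<tau> (\<sigma> t) = t\<close> for almost every \<open>t\<close> with \<open>b t \<noteq> 0\<close>, so \<open>\<eta> \<circ> \<tau>\<close> is an admissible
  curve with the same end points, the same length and constant speed \<open>k\<close>.  Since its points are
  points of \<open>\<eta>\<close>, it stays in the space of signatures.  With this reparametrization, energy and length
  are compared by the Cauchy-Schwarz inequality \<open>\<ell>\<^sup>2 \<le> 2 T J\<close>, whose equality case is constant speed,
  and length and time by passing to unit speed.
\<close>

subsection \<open>Primitives of integrable functions\<close>

text \<open>A Lebesgue measurable function composed with a measurable map may fail to be measurable.
  Controls are therefore replaced by Borel versions before they are composed with a time change. The
  version is built coordinate by coordinate from the scalar case.\<close>

lemma ex_borel_version:
  fixes f :: "'a::euclidean_space \<Rightarrow> 'b::euclidean_space"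
  assumes "f \<in> borel_measurable (lebesgue_on S)" "S \<in> sets lebesgue"
  obtains g where "g \<in> borel_measurable borel" "AE x in lebesgue_on S. f x = g x"
proof -
  let ?f = "\<lambda>x. if x \<in> S then f x else 0"
  have f: "?f \<in> borel_measurable lebesgue"
    using assms by (rule borel_measurable_if_I)
  have "\<exists>g'\<in>borel_measurable lborel. AE x in lborel. ?f x \<bullet> i = g' x" for i
    by (rule completion_ex_borel_measurable_real) (use f in measurable)
  then obtain h where h: "\<And>i. h i \<in> borel_measurable lborel" "\<And>i. AE x in lborel. ?f x \<bullet> i = h i x"
    by metis
  define g where "g x = (\<Sum>i\<in>Basis. h i x *\<^sub>R i)" for x
  have "AE x in lborel. \<forall>i\<in>Basis. ?f x \<bullet> i = h i x"
    by (rule AE_finite_allI) (rule finite_Basis, rule h(2))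
  then have "AE x in lebesgue. ?f x = g x"
    unfolding AE_completion_iff g_def
    by eventually_elim (simp add: euclidean_eq_iff[where 'a='b])
  then have "AE x in lebesgue_on S. f x = g x"
    using assms by (subst AE_restrict_space_iff) (auto elim!: eventually_mono)
  moreover have "g \<in> borel_measurable borel"
    unfolding g_def using h(1) by simp
  ultimately show ?thesis
    using that by blast
qed

lemma finite_measure_lebesgue_on_Icc: "finite_measure (lebesgue_on {a..b::real})"
  using finite_measure_lebesgue_on[OF lmeasurable_cbox[of a b]] by simp

lemma measure_lebesgue_on_Icc: "0 \<le> T \<Longrightarrow> measure (lebesgue_on {0..T}) {0..T} = (T::real)"
  by (simp add: measure_restrict_space)

lemma integral_lebesgue_on_Icc_const:
  "0 \<le> T \<Longrightarrow> (LINT t|lebesgue_on {0..T}. c) = T * (c::real)"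
  by (simp add: measure_lebesgue_on_Icc)

lemma integrable_lebesgue_on_subset:
  fixes f :: "'a::euclidean_space \<Rightarrow> 'b::euclidean_space"
  assumes "integrable (lebesgue_on T) f" "S \<subseteq> T" "S \<in> sets lebesgue" "T \<in> sets lebesgue"
  shows "integrable (lebesgue_on S) f"
proof -
  have "integrable (lebesgue_on T) (\<lambda>x. indicator S x *\<^sub>R f x)"
    using assms by (intro integrable_mult_indicator) (auto simp: sets_restrict_space)
  then have "integrable lebesgue (\<lambda>x. indicator T x *\<^sub>R indicator S x *\<^sub>R f x)"
    using assms by (simp add: integrable_restrict_space)
  also have "(\<lambda>x. indicator T x *\<^sub>R indicator S x *\<^sub>R f x) = (\<lambda>x. indicator S x *\<^sub>R f x)"
    using assms by (auto simp: indicator_def fun_eq_iff)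
  finally show ?thesis
    using assms by (simp add: integrable_restrict_space)
qed

lemma AE_lebesgue_on_subset:
  assumes "AE x in lebesgue_on T. P x" "S \<subseteq> T" "S \<in> sets lebesgue" "T \<in> sets lebesgue"
  shows "AE x in lebesgue_on S. P x"
  using assms by (auto simp: AE_restrict_space_iff elim!: eventually_mono)

text \<open>This is the integral that occurs in \<open>H1_on\<close>, as a function of the end
  point. For negative \<open>t\<close> the domain of integration is empty and the value is
  0.\<close>

definition primitive :: "(real \<Rightarrow> 'a::euclidean_space) \<Rightarrow> real \<Rightarrow> 'a" where
  "primitive f t = (LINT s|lebesgue_on {0..t}. f s)"

lemma primitive_eq_integral:
  assumes "integrable (lebesgue_on {0..T}) f" "t \<le> T"
  shows "primitive f t = integral {0..t} f"
  unfolding primitive_def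
  by (intro lebesgue_integral_eq_integral integrable_lebesgue_on_subset[OF assms(1)])
     (use assms in auto)

lemma primitive_0 [simp]: "primitive f 0 = 0"
  unfolding primitive_def
proof (rule integral_eq_zero_AE)
  have "AE x in lebesgue. x \<noteq> (0::real)"
    by (intro AE_completion AE_lborel_singleton)
  then show "AE s in lebesgue_on {0..0}. f s = 0"
    by (subst AE_restrict_space_iff) (simp, erule eventually_mono, simp)
qed

lemma continuous_on_primitive:
  assumes "integrable (lebesgue_on {0..T}) f"
  shows "continuous_on {0..T} (primitive f)"
proof -
  have "f integrable_on {0..T}"
    by (intro integrable_on_lebesgue_on assms) auto
  then have "continuous_on {0..T} (\<lambda>t. integral {0..t} f)"
    by (rule indefinite_integral_continuous_1)
  then show ?thesis
    by (rule continuous_on_eq) (auto simp: primitive_eq_integral[OF assms])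
qed

lemma primitive_mono:
  fixes f :: "real \<Rightarrow> real"
  assumes "integrable (lebesgue_on {0..T}) f" "\<And>t. t \<in> {0..T} \<Longrightarrow> 0 \<le> f t"
  shows "mono_on {0..T} (primitive f)"
  unfolding primitive_def
proof (rule mono_onI)
  fix r s assume rs: "r \<in> {0..T}" "s \<in> {0..T}" "r \<le> s"
  show "(LINT t|lebesgue_on {0..r}. f t) \<le> (LINT t|lebesgue_on {0..s}. f t)"
  proof (rule integral_mono_lebesgue_on_AE)
    show "integrable (lebesgue_on {0..s}) f"
      using rs by (intro integrable_lebesgue_on_subset[OF assms(1)]) auto
    show "AE t in lebesgue_on {0..s}. 0 \<le> f t"
      using rs assms(2) by (intro AE_I2) simp
  qed (use rs in auto)
qed

section \<open>Change of variables along a nondecreasing primitive\<close>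

lemma measurable_borel_lebesgue_on:
  "f \<in> borel_measurable borel \<Longrightarrow> f \<in> borel_measurable (lebesgue_on S)"
  by (intro measurable_restrict_space1 measurable_completion) simp

lemma sets_lebesgue_on_Int:
  assumes "S \<in> sets borel"
  shows "S \<inter> \<Omega> \<in> sets (lebesgue_on \<Omega>)"
proof -
  have "S \<in> sets lebesgue" using assms by (intro sets_completionI_sets) simp
  then show ?thesis by (auto simp: sets_restrict_space)
qed

lemma integrable_indicator_lebesgue_on:
  fixes f :: "real \<Rightarrow> 'a::euclidean_space"
  assumes "integrable (lebesgue_on {0..T}) f" "S \<in> sets borel"
  shows "integrable (lebesgue_on {0..T}) (\<lambda>s. indicator S s *\<^sub>R f s)"
proof -
  have "integrable (lebesgue_on {0..T}) (\<lambda>s. indicator (S \<inter> {0..T}) s *\<^sub>R f s)"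
    using assms by (intro integrable_mult_indicator sets_lebesgue_on_Int)
  then show ?thesis
    by (rule Bochner_Integration.integrable_cong[THEN iffD1, rotated 2]) (auto simp: indicator_def)
qed

lemma integral_indicator_primitive:
  fixes f :: "real \<Rightarrow> 'a::euclidean_space"
  assumes "t \<le> T"
  shows "(LINT s|lebesgue_on {0..T}. indicator {..t} s *\<^sub>R f s) = primitive f t"
proof -
  have *: "indicator {0..T} s *\<^sub>R indicator {..t} s *\<^sub>R f s = indicator {0..t} s *\<^sub>R f s" for s
    using assms by (auto simp: indicator_def)
  show ?thesis
    by (simp add: primitive_def integral_restrict_space * del: scaleR_scaleR)
qed

lemma integral_indicator_greaterThan:
  fixes f :: "real \<Rightarrow> 'a::euclidean_space"
  assumes f: "integrable (lebesgue_on {0..T}) f" and "t \<le> T"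
  shows "(LINT s|lebesgue_on {0..T}. indicator {t<..} s *\<^sub>R f s) = primitive f T - primitive f t"
proof -
  have "indicator {t<..} s *\<^sub>R f s = f s - indicator {..t} s *\<^sub>R f s" for s
    by (auto simp: indicator_def)
  moreover have "integrable (lebesgue_on {0..T}) (\<lambda>s. indicator {..t} s *\<^sub>R f s)"
    by (intro integrable_indicator_lebesgue_on f) auto
  ultimately have "(LINT s|lebesgue_on {0..T}. indicator {t<..} s *\<^sub>R f s)
      = (LINT s|lebesgue_on {0..T}. f s) - primitive f t"
    using f by (simp add: integral_indicator_primitive[OF assms(2), symmetric])
  then show ?thesis by (simp add: primitive_def)
qed

text \<open>Two measures on the line that are finite and equal on all rays \<open>{x<..}\<close>
  coincide. Since \<open>primitive \<rho>\<close> is continuous and nondecreasing, the preimage of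
  such a ray in \<open>{0..T}\<close> has the form \<open>{t0<..} \<inter> {0..T}\<close>, and its
  mass is the increment of the primitive from \<open>t0\<close> to \<open>T\<close>.\<close>

lemma distr_density_primitive:
  fixes \<rho> :: "real \<Rightarrow> real"
  assumes \<rho>: "integrable (lebesgue_on {0..T}) \<rho>" "\<And>t. t \<in> {0..T} \<Longrightarrow> 0 \<le> \<rho> t" and "0 \<le> T"
  shows "distr (density (lebesgue_on {0..T}) (\<lambda>t. ennreal (\<rho> t))) borel (primitive \<rho>)
       = density lborel (indicator {0..primitive \<rho> T})" (is "?A = ?B")
proof (rule measure_eqI_lessThan)
  let ?M = "lebesgue_on {0..T}" and ?\<sigma> = "primitive \<rho>"
  have cont: "continuous_on {0..T} ?\<sigma>" and mono: "mono_on {0..T} ?\<sigma>"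
    using \<rho> by (auto intro: continuous_on_primitive primitive_mono)
  have [measurable]: "?\<sigma> \<in> borel_measurable ?M"
    by (rule continuous_imp_measurable_on_sets_lebesgue[OF cont]) auto
  have [measurable]: "\<rho> \<in> borel_measurable ?M"
    using \<rho>(1) by auto
  have L0: "0 \<le> ?\<sigma> T"
    using mono_onD[OF mono, of 0 T] \<open>0 \<le> T\<close> by auto
  fix x :: real
  have B: "emeasure ?B {x<..} = ennreal (?\<sigma> T - max x 0)"
  proof -
    have "emeasure ?B {x<..} = emeasure lborel ({0..?\<sigma> T} \<inter> {x<..})"
      by (simp add: emeasure_density indicator_inter_arith[symmetric])
    also have "\<dots> = ennreal (?\<sigma> T - max x 0)"
    proof (cases "x < 0")
      case True
      then have "{0..?\<sigma> T} \<inter> {x<..} = {0..?\<sigma> T}" by auto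
      then show ?thesis using L0 True by simp
    next
      case False
      then have "{0..?\<sigma> T} \<inter> {x<..} = {x<..?\<sigma> T}" by auto
      then show ?thesis using False by (cases "x \<le> ?\<sigma> T") (auto simp: ennreal_neg)
    qed
    finally show ?thesis .
  qed
  have "emeasure ?A {x<..} = emeasure (density ?M (\<lambda>t. ennreal (\<rho> t))) (?\<sigma> -` {x<..} \<inter> {0..T})"
    by (subst emeasure_distr) (simp_all add: \<open>?\<sigma> \<in> borel_measurable ?M\<close>)
  also have "\<dots> = (\<integral>\<^sup>+t. ennreal (\<rho> t) * indicator (?\<sigma> -` {x<..} \<inter> {0..T}) t \<partial>?M)"
  proof (rule emeasure_density)
    have "?\<sigma> -` {x<..} \<inter> space ?M \<in> sets ?M"
      by (rule measurable_sets[of _ _ borel]) auto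
    then show "?\<sigma> -` {x<..} \<inter> {0..T} \<in> sets ?M" by simp
  qed measurable
  also have "\<dots> = ennreal (?\<sigma> T - max x 0)"
  proof -
    \<comment> \<open>The ray starts below, inside or above the range of the primitive. The cut
      \<open>t0\<close> is -1 in the first case, where the primitive is 0 by convention, the last
      point with value at most \<open>x\<close> in the second, and \<open>T\<close> in the
      third.\<close>
    consider "x < 0" | "0 \<le> x" "x < ?\<sigma> T" | "?\<sigma> T \<le> x" by linarith
    then obtain t0 where t0: "t0 \<le> T" "?\<sigma> -` {x<..} \<inter> {0..T} = {t0<..} \<inter> {0..T}"
      "?\<sigma> T - ?\<sigma> t0 = max 0 (?\<sigma> T - max x 0)"
    proof cases
      case 1
      have "0 \<le> ?\<sigma> t" if "t \<in> {0..T}" for t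
        using mono_onD[OF mono, of 0 t] that by auto
      then have "?\<sigma> -` {x<..} \<inter> {0..T} = {-1<..} \<inter> {0..T}" using 1 by force
      moreover have "?\<sigma> (-1) = 0" by (simp add: primitive_def)
      ultimately show ?thesis using that[of "-1"] 1 L0 \<open>0 \<le> T\<close> by auto
    next
      case 2
      let ?K = "{t \<in> {0..T}. ?\<sigma> t \<le> x}"
      have "closed ({0..T} \<inter> ?\<sigma> -` {..x})"
        by (intro continuous_closed_preimage cont) auto
      moreover have "{0..T} \<inter> ?\<sigma> -` {..x} = ?K" by auto
      ultimately have "compact ?K"
        using bounded_subset[OF bounded_closed_interval, of ?K 0 T] by (auto simp: compact_eq_bounded_closed)
      moreover have "0 \<in> ?K" using 2 \<open>0 \<le> T\<close> by auto
      ultimately obtain t0 where t0: "t0 \<in> ?K" "\<And>t. t \<in> ?K \<Longrightarrow> t \<le> t0"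
        using compact_attains_sup[of ?K] by blast
      \<comment> \<open>A point to the right of \<open>t0\<close> with value \<open>x\<close> again
        lies in \<open>?K\<close>, so maximality of \<open>t0\<close> makes it equal to
        \<open>t0\<close>.\<close>
      have "\<exists>t\<ge>t0. t \<le> T \<and> ?\<sigma> t = x"
        by (rule IVT') (use t0 2 in \<open>auto intro: continuous_on_subset[OF cont]\<close>)
      then have "?\<sigma> t0 = x" using t0 by (metis (mono_tags, lifting) antisym_conv atLeastAtMost_iff mem_Collect_eq order_trans order_refl)
      moreover have "?\<sigma> -` {x<..} \<inter> {0..T} = {t0<..} \<inter> {0..T}"
      proof (intro set_eqI iffI)
        fix t assume t: "t \<in> ?\<sigma> -` {x<..} \<inter> {0..T}"
        then have "t0 < t" using mono_onD[OF mono, of t t0] t0 by force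
        with t show "t \<in> {t0<..} \<inter> {0..T}" by auto
      next
        fix t assume t: "t \<in> {t0<..} \<inter> {0..T}"
        then have "\<not> ?\<sigma> t \<le> x" using t0(2)[of t] by auto
        with t show "t \<in> ?\<sigma> -` {x<..} \<inter> {0..T}" by auto
      qed
      ultimately show ?thesis using that[of t0] 2 t0 by auto
    next
      case 3
      have "?\<sigma> t \<le> ?\<sigma> T" if "t \<in> {0..T}" for t
        using mono_onD[OF mono, of t T] that by auto
      then have "?\<sigma> -` {x<..} \<inter> {0..T} = {T<..} \<inter> {0..T}" using 3 by force
      then show ?thesis using that[of T] 3 L0 by auto
    qed
    have "(\<integral>\<^sup>+t. ennreal (\<rho> t) * indicator (?\<sigma> -` {x<..} \<inter> {0..T}) t \<partial>?M)
        = (\<integral>\<^sup>+t. ennreal (indicator {t0<..} t *\<^sub>R \<rho> t) \<partial>?M)"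
      unfolding t0(2) by (intro nn_integral_cong) (auto simp: indicator_def)
    also have "\<dots> = ennreal (LINT t|?M. indicator {t0<..} t *\<^sub>R \<rho> t)"
      by (intro nn_integral_eq_integral integrable_indicator_lebesgue_on \<rho>)
         (auto intro!: AE_I2 \<rho>(2) mult_nonneg_nonneg)
    also have "\<dots> = ennreal (?\<sigma> T - max x 0)"
      using t0 by (subst integral_indicator_greaterThan[OF \<rho>(1)]) (auto simp: max_def ennreal_neg)
    finally show ?thesis .
  qed
  finally have A: "emeasure ?A {x<..} = ennreal (?\<sigma> T - max x 0)" .
  show "emeasure ?A {x<..} = emeasure ?B {x<..}" unfolding A B ..
  show "emeasure ?A {x<..} < \<infinity>" unfolding A by simp
qed auto

text \<open>Both sides integrate \<open>g\<close> against the same measure, seen once as Lebesgue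
  measure on the image interval and once as the push-forward of the density \<open>\<rho>\<close>.
  Flat pieces of the primitive carry no mass, so injectivity plays no part in the argument. Taking
  \<open>g\<close> Borel makes its composition with the primitive measurable.\<close>

lemma substitution_primitive:
  fixes g :: "real \<Rightarrow> 'a::euclidean_space"
  assumes \<rho>: "integrable (lebesgue_on {0..T}) \<rho>" "\<And>t. t \<in> {0..T} \<Longrightarrow> 0 \<le> \<rho> t"
    and t: "t \<in> {0..T}" and g: "g \<in> borel_measurable borel"
  shows "primitive g (primitive \<rho> t) = primitive (\<lambda>s. \<rho> s *\<^sub>R g (primitive \<rho> s)) t"
proof -
  let ?M = "lebesgue_on {0..t}" and ?\<sigma> = "primitive \<rho>"
  have \<rho>': "integrable ?M \<rho>" "\<And>s. s \<in> {0..t} \<Longrightarrow> 0 \<le> \<rho> s"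
    using t \<rho>(2) by (auto intro: integrable_lebesgue_on_subset[OF \<rho>(1)])
  have \<sigma>: "?\<sigma> \<in> borel_measurable ?M"
    by (rule continuous_imp_measurable_on_sets_lebesgue[OF continuous_on_primitive[OF \<rho>'(1)]]) auto
  have g\<sigma>: "(\<lambda>s. g (?\<sigma> s)) \<in> borel_measurable ?M"
    using measurable_compose[OF \<sigma> g] .
  have "primitive g (?\<sigma> t) = (LINT u|density lborel (\<lambda>u. ennreal (indicator {0..?\<sigma> t} u)). g u)"
    using g by (simp add: primitive_def integral_restrict_space integral_density integral_completion)
  also have "density lborel (\<lambda>u. ennreal (indicator {0..?\<sigma> t} u)) = distr (density ?M (\<lambda>s. ennreal (\<rho> s))) borel ?\<sigma>"
    using distr_density_primitive[OF \<rho>'] t by (simp add: ennreal_indicator)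
  also have "(LINT u|\<dots>. g u) = (LINT s|density ?M (\<lambda>s. ennreal (\<rho> s)). g (?\<sigma> s))"
    using g \<sigma> by (intro integral_distr) auto
  also have "\<dots> = (LINT s|?M. \<rho> s *\<^sub>R g (?\<sigma> s))"
    using \<rho>' g\<sigma> by (intro integral_density) (auto intro!: AE_I2)
  finally show ?thesis by (simp add: primitive_def)
qed

text \<open>The null-set form of the push-forward identity: a set is null for the image interval
  exactly when its preimage is null for the density \<open>\<rho>\<close>, and this density ignores
  the points where \<open>\<rho>\<close> vanishes.\<close>

lemma AE_lebesgue_on_primitive_iff:
  fixes \<rho> :: "real \<Rightarrow> real"
  assumes \<rho>: "integrable (lebesgue_on {0..T}) \<rho>" "\<And>t. t \<in> {0..T} \<Longrightarrow> 0 \<le> \<rho> t" and "0 \<le> T"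
    and P: "{u. P u} \<in> sets borel"
  shows "(AE u in lebesgue_on {0..primitive \<rho> T}. P u) \<longleftrightarrow>
         (AE t in lebesgue_on {0..T}. \<rho> t \<noteq> 0 \<longrightarrow> P (primitive \<rho> t))"
proof -
  let ?M = "lebesgue_on {0..T}" and ?\<sigma> = "primitive \<rho>"
  have \<sigma>: "?\<sigma> \<in> borel_measurable ?M"
    by (rule continuous_imp_measurable_on_sets_lebesgue[OF continuous_on_primitive[OF \<rho>(1)]]) auto
  have \<rho>m: "\<rho> \<in> borel_measurable ?M"
    using \<rho>(1) by auto
  have "(AE u in lebesgue_on {0..?\<sigma> T}. P u) \<longleftrightarrow> (AE u in lborel. u \<in> {0..?\<sigma> T} \<longrightarrow> P u)"
    by (simp add: AE_restrict_space_iff AE_completion_iff)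
  also have "\<dots> \<longleftrightarrow> (AE u in lborel. 0 < (indicator {0..?\<sigma> T} u :: ennreal) \<longrightarrow> P u)"
    by (intro AE_cong) (auto simp: indicator_def)
  also have "\<dots> \<longleftrightarrow> (AE u in density lborel (indicator {0..?\<sigma> T}). P u)"
    by (intro AE_density[symmetric]) simp
  also have "\<dots> \<longleftrightarrow> (AE u in distr (density ?M (\<lambda>t. ennreal (\<rho> t))) borel ?\<sigma>. P u)"
    by (subst distr_density_primitive[OF \<rho> \<open>0 \<le> T\<close>]) simp_all
  also have "\<dots> \<longleftrightarrow> (AE t in density ?M (\<lambda>t. ennreal (\<rho> t)). P (?\<sigma> t))"
    using P \<sigma> by (intro AE_distr_iff) simp_all
  also have "\<dots> \<longleftrightarrow> (AE t in ?M. 0 < ennreal (\<rho> t) \<longrightarrow> P (?\<sigma> t))"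
    using \<rho>m by (intro AE_density) simp
  also have "\<dots> \<longleftrightarrow> (AE t in ?M. \<rho> t \<noteq> 0 \<longrightarrow> P (?\<sigma> t))"
    using \<rho>(2) by (intro AE_cong) (auto simp: less_le)
  finally show ?thesis .
qed

text \<open>Any choice of preimages is monotone: an inversion of two chosen points would, by
  monotonicity of \<open>\<sigma>\<close>, invert their values. Monotonicity later supplies Borel
  measurability of \<open>\<tau>\<close>, which may jump where \<open>\<sigma>\<close> is
  flat.\<close>

lemma ex_mono_right_inverse:
  fixes \<sigma> :: "real \<Rightarrow> real"
  assumes mono: "mono_on {0..T} \<sigma>" and cont: "continuous_on {0..T} \<sigma>" and "0 \<le> T"
  obtains \<tau> where "mono \<tau>" "\<And>s. \<tau> s \<in> {0..T}" "\<And>s. s \<in> {\<sigma> 0..\<sigma> T} \<Longrightarrow> \<sigma> (\<tau> s) = s"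
proof -
  have "\<exists>t. t \<in> {0..T} \<and> \<sigma> t = s" if "s \<in> {\<sigma> 0..\<sigma> T}" for s
    using IVT'[of \<sigma> 0 s T] that cont \<open>0 \<le> T\<close> by auto
  then obtain h where h: "\<And>s. s \<in> {\<sigma> 0..\<sigma> T} \<Longrightarrow> h s \<in> {0..T} \<and> \<sigma> (h s) = s"
    by metis
  have le: "\<sigma> 0 \<le> \<sigma> T"
    using mono_onD[OF mono, of 0 T] \<open>0 \<le> T\<close> by auto
  have h_mono: "h s \<le> h s'" if "s \<in> {\<sigma> 0..\<sigma> T}" "s' \<in> {\<sigma> 0..\<sigma> T}" "s \<le> s'" for s s'
  proof (cases "s = s'")
    case False
    show ?thesis
    proof (rule ccontr)
      assume "\<not> h s \<le> h s'"
      then have "\<sigma> (h s') \<le> \<sigma> (h s)"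
        using h that by (intro mono_onD[OF mono]) auto
      then show False using h that False by auto
    qed
  qed simp
  \<comment> \<open>Clamping the argument to the range of \<open>\<sigma>\<close> makes
    \<open>\<tau>\<close> monotone on the whole line with values in \<open>{0..T}\<close>.\<close>
  define \<tau> where "\<tau> s = h (max (\<sigma> 0) (min (\<sigma> T) s))" for s
  show ?thesis
  proof
    show "mono \<tau>"
      unfolding \<tau>_def mono_def using le by (auto intro!: h_mono)
    show "\<tau> s \<in> {0..T}" for s
      using h[of "max (\<sigma> 0) (min (\<sigma> T) s)"] le by (auto simp: \<tau>_def)
    show "\<sigma> (\<tau> s) = s" if "s \<in> {\<sigma> 0..\<sigma> T}" for s
      using h[OF that] that by (auto simp: \<tau>_def)
  qed
qed

text \<open>A point \<open>t\<close> violating the conclusion lies on an interval where the primitive is constant;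
  such an interval contains a rational, and the values at rationals form a null set.\<close>

lemma AE_right_inverse_primitive:
  fixes \<rho> :: "real \<Rightarrow> real"
  assumes \<rho>: "integrable (lebesgue_on {0..T}) \<rho>" "\<And>t. t \<in> {0..T} \<Longrightarrow> 0 \<le> \<rho> t" and "0 \<le> T"
    and \<tau>: "\<And>s. \<tau> s \<in> {0..T}" "\<And>s. s \<in> {0..primitive \<rho> T} \<Longrightarrow> primitive \<rho> (\<tau> s) = s"
  shows "AE t in lebesgue_on {0..T}. \<rho> t \<noteq> 0 \<longrightarrow> \<tau> (primitive \<rho> t) = t"
proof -
  let ?\<sigma> = "primitive \<rho>"
  let ?Z = "?\<sigma> ` (\<rat> \<inter> {0..T})"
  have mono: "mono_on {0..T} ?\<sigma>"
    using \<rho> by (rule primitive_mono)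
  have Z: "countable ?Z"
    by (intro countable_image countable_Int1 countable_rat)
  then have "AE u in lborel. u \<notin> ?Z"
    by (intro AE_not_in countable_imp_null_set_lborel)
  then have "AE u in lebesgue_on {0..?\<sigma> T}. u \<notin> ?Z"
    by (subst AE_restrict_space_iff) (auto simp: AE_completion_iff elim: eventually_mono)
  moreover have "{u. u \<notin> ?Z} \<in> sets borel"
    using sets.compl_sets[OF sets.countable[OF _ Z, of borel]] by (simp add: Compl_eq_Diff_UNIV[symmetric] Compl_eq)
  ultimately have "AE t in lebesgue_on {0..T}. \<rho> t \<noteq> 0 \<longrightarrow> ?\<sigma> t \<notin> ?Z"
    using AE_lebesgue_on_primitive_iff[OF \<rho> \<open>0 \<le> T\<close>, of "\<lambda>u. u \<notin> ?Z"] by simp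
  moreover have "\<tau> (?\<sigma> t) = t" if t: "t \<in> {0..T}" and nZ: "?\<sigma> t \<notin> ?Z" for t
  proof (rule ccontr)
    let ?p = "\<tau> (?\<sigma> t)"
    assume "?p \<noteq> t"
    then obtain q where q: "q \<in> \<rat>" "min ?p t < q" "q < max ?p t"
      using Rats_dense_in_real[of "min ?p t" "max ?p t"] by (metis less_max_iff_disj linorder_neqE_linordered_idom min_less_iff_disj)
    have p: "?p \<in> {0..T}" by (rule \<tau>)
    have "?\<sigma> t \<in> {0..?\<sigma> T}"
      using mono_onD[OF mono, of 0 t] mono_onD[OF mono, of t T] t by auto
    then have "?\<sigma> ?p = ?\<sigma> t" by (rule \<tau>)
    moreover have "?\<sigma> (min ?p t) \<le> ?\<sigma> q" "?\<sigma> q \<le> ?\<sigma> (max ?p t)"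
      using p t q by (auto intro!: mono_onD[OF mono])
    ultimately have "?\<sigma> q = ?\<sigma> t"
      by (auto simp: min_def max_def split: if_splits)
    moreover have "q \<in> \<rat> \<inter> {0..T}" using q p t by auto
    ultimately show False using nZ by (metis imageI)
  qed
  then have "AE t in lebesgue_on {0..T}. ?\<sigma> t \<notin> ?Z \<longrightarrow> \<tau> (?\<sigma> t) = t"
    by (intro AE_I2) simp
  ultimately show ?thesis by eventually_elim simp
qed

text \<open>Extend a Borel version of \<open>f\<close> by zero to a function \<open>g\<close> on the
  line. Its integral over every ray vanishes, so the positive and the negative part of
  \<open>g\<close> are densities of the same measure. Uniqueness of densities makes the two parts
  equal almost everywhere, and then both are zero.\<close>

lemma AE_zero_if_primitive_zero:
  fixes f :: "real \<Rightarrow> real"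
  assumes f: "integrable (lebesgue_on {0..T}) f" and zero: "\<And>t. t \<in> {0..T} \<Longrightarrow> primitive f t = 0"
  shows "AE t in lebesgue_on {0..T}. f t = 0"
proof -
  let ?M = "lebesgue_on {0..T}"
  obtain f' where f': "f' \<in> borel_measurable borel" and ae: "AE t in ?M. f t = f' t"
    by (rule ex_borel_version[of f "{0..T}"]) (use f in auto)
  have f'M: "f' \<in> borel_measurable ?M"
    using f' by (rule measurable_borel_lebesgue_on)
  have f'_int: "integrable ?M f'"
    using integrable_cong_AE[OF _ f'M ae] f by auto
  define g where "g s = indicator {0..T} s *\<^sub>R f' s" for s
  have g: "integrable lborel g"
    using f'_int f' unfolding g_def by (simp add: integrable_restrict_space integrable_completion)
  have g0: "(LINT s|lborel. indicator {x<..} s *\<^sub>R g s) = 0" for x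
  proof -
    have "(LINT s|lborel. indicator {x<..} s *\<^sub>R g s) = (LINT s|?M. indicator {x<..} s *\<^sub>R f' s)"
      using f' unfolding g_def by (simp add: integral_restrict_space integral_completion mult.left_commute)
    also have "\<dots> = (LINT s|?M. indicator {x<..} s *\<^sub>R f s)"
      by (rule integral_cong_AE)
         (use f'M ae f integrable_indicator_lebesgue_on[OF f'_int, of "{x<..}"]
            integrable_indicator_lebesgue_on[OF f, of "{x<..}"] in auto)
    also have "\<dots> = 0"
    proof (cases "x \<in> {0..T}")
      case True
      then show ?thesis
        using integral_indicator_greaterThan[OF f, of x] zero[of x] zero[of T] by simp
    next
      case False
      then consider "T < x" | "x < 0" by fastforce
      then show ?thesis
      proof cases
        case 1
        then show ?thesis
          by (intro integral_eq_zero_AE AE_I2) (auto simp: indicator_def)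
      next
        case 2
        have "(LINT s|?M. indicator {x<..} s *\<^sub>R f s) = (LINT s|?M. f s)"
          by (rule Bochner_Integration.integral_cong) (use 2 in \<open>auto simp: indicator_def\<close>)
        also have "\<dots> = 0"
          using zero[of T] by (cases "0 \<le> T") (auto simp: primitive_def)
        finally show ?thesis .
      qed
    qed
    finally show ?thesis .
  qed
  have [measurable]: "g \<in> borel_measurable lborel" using g by auto
  \<comment> \<open>\<open>ennreal\<close> sends negative numbers to 0, so the two densities are the
    positive and the negative part of \<open>g\<close>.\<close>
  have "density lborel (\<lambda>s. ennreal (g s)) = density lborel (\<lambda>s. ennreal (- g s))"
  proof (rule measure_eqI_lessThan)
    fix x :: real
    let ?h = "\<lambda>s. indicator {x<..} s *\<^sub>R g s"
    have h: "integrable lborel ?h"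
      by (intro integrable_mult_indicator g) auto
    have fin: "(\<integral>\<^sup>+s. ennreal (?h s) \<partial>lborel) < \<infinity>" "(\<integral>\<^sup>+s. ennreal (- ?h s) \<partial>lborel) < \<infinity>"
      using h by (simp_all add: real_integrable_def less_top)
    have "enn2real (\<integral>\<^sup>+s. ennreal (?h s) \<partial>lborel) = enn2real (\<integral>\<^sup>+s. ennreal (- ?h s) \<partial>lborel)"
      using real_lebesgue_integral_def[OF h] g0[of x] by simp
    then have eq: "(\<integral>\<^sup>+s. ennreal (?h s) \<partial>lborel) = (\<integral>\<^sup>+s. ennreal (- ?h s) \<partial>lborel)"
      using fin by (metis ennreal_enn2real infinity_ennreal_def)
    have 1: "emeasure (density lborel (\<lambda>s. ennreal (g s))) {x<..} = (\<integral>\<^sup>+s. ennreal (?h s) \<partial>lborel)"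
      by (subst emeasure_density) (auto intro!: nn_integral_cong simp: indicator_def)
    have 2: "emeasure (density lborel (\<lambda>s. ennreal (- g s))) {x<..} = (\<integral>\<^sup>+s. ennreal (- ?h s) \<partial>lborel)"
      by (subst emeasure_density) (auto intro!: nn_integral_cong simp: indicator_def)
    show "emeasure (density lborel (\<lambda>s. ennreal (g s))) {x<..}
        = emeasure (density lborel (\<lambda>s. ennreal (- g s))) {x<..}"
      unfolding 1 2 by (rule eq)
    show "emeasure (density lborel (\<lambda>s. ennreal (g s))) {x<..} < \<infinity>"
      unfolding 1 using fin by simp
  qed auto
  then have "AE s in lborel. ennreal (g s) = ennreal (- g s)"
    by (intro sigma_finite_measure.density_unique[OF sigma_finite_lborel]) auto
  then have "AE s in lborel. g s = 0"
  proof eventually_elim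
    case (elim s)
    then show ?case
      using ennreal_inj[of "g s" 0] ennreal_inj[of "- g s" 0]
      by (cases "0 \<le> g s") (auto simp: ennreal_neg)
  qed
  then have "AE s in ?M. f' s = 0"
    by (subst AE_restrict_space_iff) (auto simp: g_def AE_completion_iff elim: eventually_mono)
  with ae show ?thesis by eventually_elim simp
qed

section \<open>Square-integrable functions on a compact interval\<close>

lemma L2_on_integrable:
  assumes "L2_on T v"
  shows "integrable (lebesgue_on {0..T}) v"
proof (rule Bochner_Integration.integrable_bound)
  show "integrable (lebesgue_on {0..T}) (\<lambda>t. 1 + (norm (v t))\<^sup>2)"
    using assms finite_measure.integrable_const[OF finite_measure_lebesgue_on_Icc[of 0 T], of "1::real"]
    by (auto simp: L2_on_def)
  have "x \<le> 1 + x\<^sup>2" for x :: real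
    using zero_le_power2[of "x - 1/2"] by (simp add: power2_eq_square algebra_simps)
  then show "AE t in lebesgue_on {0..T}. norm (v t) \<le> norm (1 + (norm (v t))\<^sup>2)"
    by (intro AE_I2) (simp add: abs_of_nonneg add_nonneg_nonneg)
qed (use assms in \<open>auto simp: L2_on_def\<close>)

lemma L2_on_bounded:
  assumes "v \<in> borel_measurable (lebesgue_on {0..T})" "\<And>t. t \<in> {0..T} \<Longrightarrow> norm (v t) \<le> K"
  shows "L2_on T v"
  unfolding L2_on_def
proof
  show "integrable (lebesgue_on {0..T}) (\<lambda>t. (norm (v t))\<^sup>2)"
  proof (rule finite_measure.integrable_const_bound[OF finite_measure_lebesgue_on_Icc, where B="K\<^sup>2"])
    show "AE t in lebesgue_on {0..T}. norm ((norm (v t))\<^sup>2) \<le> K\<^sup>2"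
      using assms(2) by (intro AE_I2) (auto intro!: power_mono)
  qed (use assms(1) in measurable)
qed (rule assms)

lemma primitive_cong_AE:
  fixes f g :: "real \<Rightarrow> 'a::euclidean_space"
  assumes "f \<in> borel_measurable (lebesgue_on {0..T})" "g \<in> borel_measurable (lebesgue_on {0..T})"
    and "AE t in lebesgue_on {0..T}. f t = g t" and "t \<le> T"
  shows "primitive f t = primitive g t"
  unfolding primitive_def
proof (rule integral_cong_AE)
  have sub: "h \<in> borel_measurable (lebesgue_on {0..t})" if "h \<in> borel_measurable (lebesgue_on {0..T})" for h :: "real \<Rightarrow> 'a"
    using measurable_restrict_mono[OF that] assms(4) by simp
  show "f \<in> borel_measurable (lebesgue_on {0..t})" "g \<in> borel_measurable (lebesgue_on {0..t})"
    using assms by (auto intro: sub)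
  show "AE s in lebesgue_on {0..t}. f s = g s"
    by (rule AE_lebesgue_on_subset[OF assms(3)]) (use assms in auto)
qed

subsection \<open>Constant-speed reparametrization of admissible curves\<close>

lemma L2_on_cong_AE:
  assumes "L2_on T v" "v' \<in> borel_measurable (lebesgue_on {0..T})" "AE t in lebesgue_on {0..T}. v t = v' t"
  shows "L2_on T v'"
proof -
  have "integrable (lebesgue_on {0..T}) (\<lambda>t. (norm (v t))\<^sup>2)
      \<longleftrightarrow> integrable (lebesgue_on {0..T}) (\<lambda>t. (norm (v' t))\<^sup>2)"
    using assms by (intro integrable_cong_AE) (auto simp: L2_on_def)
  then show ?thesis using assms by (simp add: L2_on_def)
qed

text \<open>The right-hand side of the control equation, split by words so that each coordinate is a
  scalar function of time.\<close>

definition velocity ::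
  "nat \<Rightarrow> (real \<Rightarrow> real ^ 'd::finite) \<Rightarrow> (real \<Rightarrow> 'd tensor) \<Rightarrow> 'd list \<Rightarrow> real \<Rightarrow> real" where
  "velocity N a \<xi> w s = (\<Sum>i\<in>UNIV. a s $ i * U N i (\<xi> s) w)"

lemma continuous_on_U:
  assumes "\<And>w. continuous_on S (\<lambda>s. \<xi> s w)"
  shows "continuous_on S (\<lambda>s. U N i (\<xi> s) w)"
  unfolding U_def tensor_mult_def
  by (cases "length w \<le> N") (auto intro!: continuous_intros assms)

lemma borel_measurable_U:
  assumes "\<And>w. (\<lambda>s. \<xi> s w) \<in> borel_measurable M"
  shows "(\<lambda>s. U N i (\<xi> s) w) \<in> borel_measurable M"
  unfolding U_def tensor_mult_def
  by (cases "length w \<le> N") (auto intro!: borel_measurable_sum borel_measurable_times assms)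

lemma borel_measurable_velocity:
  assumes a: "a \<in> borel_measurable M" and \<xi>: "\<And>w. (\<lambda>s. \<xi> s w) \<in> borel_measurable M"
  shows "velocity N a \<xi> w \<in> borel_measurable M"
proof -
  have "(\<lambda>s. a s $ i) \<in> borel_measurable M" for i
    using measurable_compose[OF a, of "\<lambda>x. x $ i" borel] by (simp add: borel_measurable_continuous_onI continuous_intros)
  then show ?thesis
    unfolding velocity_def[abs_def]
    by (intro borel_measurable_sum borel_measurable_times borel_measurable_U \<xi>)
qed

lemma U_Nil: "U N i g [] = 0"
  by (simp add: U_def tensor_mult_def tensor_basis_def)

lemma U_singleton: "1 \<le> N \<Longrightarrow> U N i g [j] = (if i = j then g [] else 0)"
  by (auto simp: U_def tensor_mult_def tensor_basis_def atMost_Suc)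

lemma velocity_singleton: "1 \<le> N \<Longrightarrow> velocity N a \<xi> [j] s = a s $ j * \<xi> s []"
  by (simp add: velocity_def U_singleton if_distrib[of "\<lambda>x. _ * x"] cong: if_cong)

text \<open>The derivative \<open>D\<close> hidden in \<open>admissible_curve\<close> agrees almost
  everywhere with the explicit velocity, so the two have the same primitives. The velocity is
  measurable because the curve, being a primitive in each coordinate, is continuous. All later work
  uses this integral form.\<close>

lemma joins_iff:
  "joins N T g a \<xi> \<longleftrightarrow> L2_on T a \<and> (\<forall>s\<in>{0..T}. \<xi> s \<in> signatures N) \<and> \<xi> 0 = tensor_one \<and> \<xi> T = g \<and>
     (\<forall>w. continuous_on {0..T} (\<lambda>s. \<xi> s w) \<and> L2_on T (velocity N a \<xi> w) \<and>
          (\<forall>t\<in>{0..T}. \<xi> t w = tensor_one w + primitive (velocity N a \<xi> w) t))"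
  (is "_ \<longleftrightarrow> ?R")
proof
  assume j: "joins N T g a \<xi>"
  then obtain D where D: "\<And>w. H1_on T (\<lambda>s. \<xi> s w) (\<lambda>s. D s w)"
    and ae: "AE s in lebesgue_on {0..T}. D s = (\<lambda>w. \<Sum>i\<in>UNIV. a s $ i * U N i (\<xi> s) w)"
    by (auto simp: joins_def admissible_curve_def)
  have L2: "L2_on T (\<lambda>s. D s w)" for w
    using D by (simp add: H1_on_def)
  have eq: "\<xi> t w = tensor_one w + primitive (\<lambda>s. D s w) t" if "t \<in> {0..T}" for t w
    using D[of w] j that by (auto simp: H1_on_def joins_def primitive_def)
  have "continuous_on {0..T} (\<lambda>t. tensor_one w + primitive (\<lambda>s. D s w) t)" for w
    by (intro continuous_intros continuous_on_primitive L2_on_integrable L2)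
  then have cont: "continuous_on {0..T} (\<lambda>s. \<xi> s w)" for w
    by (rule continuous_on_eq) (simp add: eq)
  then have meas: "(\<lambda>s. \<xi> s w) \<in> borel_measurable (lebesgue_on {0..T})" for w
    by (rule continuous_imp_measurable_on_sets_lebesgue) simp
  have vm: "velocity N a \<xi> w \<in> borel_measurable (lebesgue_on {0..T})" for w
    using j by (intro borel_measurable_velocity meas) (simp add: joins_def admissible_curve_def L2_on_def)
  have vae: "AE s in lebesgue_on {0..T}. D s w = velocity N a \<xi> w s" for w
    using ae by eventually_elim (simp add: velocity_def)
  have "L2_on T (velocity N a \<xi> w)" for w
    using L2_on_cong_AE[OF L2 vm vae] .
  moreover have "primitive (\<lambda>s. D s w) t = primitive (velocity N a \<xi> w) t" if "t \<in> {0..T}" for t w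
    by (rule primitive_cong_AE[OF _ vm vae]) (use L2[of w] that in \<open>auto simp: L2_on_def\<close>)
  ultimately show ?R
    using j cont eq by (auto simp: joins_def admissible_curve_def)
next
  assume R: ?R
  then have "H1_on T (\<lambda>s. \<xi> s w) (velocity N a \<xi> w)" for w
    by (auto simp: H1_on_def primitive_def)
  then have "\<exists>D. (\<forall>w. H1_on T (\<lambda>s. \<xi> s w) (\<lambda>s. D s w)) \<and>
      (AE s in lebesgue_on {0..T}. D s = (\<lambda>w. \<Sum>i\<in>UNIV. a s $ i * U N i (\<xi> s) w))"
    by (intro exI[of _ "\<lambda>s w. velocity N a \<xi> w s"]) (simp add: velocity_def[abs_def])
  then show "joins N T g a \<xi>"
    using R by (simp add: joins_def admissible_curve_def)
qed

lemma joins_cong_AE: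
  assumes j: "joins N T g a \<xi>" and b: "b \<in> borel_measurable (lebesgue_on {0..T})"
    and ae: "AE t in lebesgue_on {0..T}. a t = b t"
  shows "joins N T g b \<xi>"
proof -
  have meas: "(\<lambda>s. \<xi> s w) \<in> borel_measurable (lebesgue_on {0..T})" for w
    using j by (intro continuous_imp_measurable_on_sets_lebesgue) (auto simp: joins_iff)
  have vae: "AE t in lebesgue_on {0..T}. velocity N a \<xi> w t = velocity N b \<xi> w t" for w
    using ae by eventually_elim (simp add: velocity_def)
  have vm: "velocity N b \<xi> w \<in> borel_measurable (lebesgue_on {0..T})" for w
    by (intro borel_measurable_velocity b meas)
  have "L2_on T b" "L2_on T (velocity N b \<xi> w)" for w
    using j L2_on_cong_AE[OF _ b ae] L2_on_cong_AE[OF _ vm vae] by (auto simp: joins_iff)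
  moreover have "primitive (velocity N a \<xi> w) t = primitive (velocity N b \<xi> w) t" if "t \<in> {0..T}" for t w
    by (rule primitive_cong_AE[OF _ vm vae]) (use j that in \<open>auto simp: joins_iff L2_on_def\<close>)
  ultimately show ?thesis using j by (simp add: joins_iff)
qed

text \<open>The coordinate at the empty word has velocity zero and keeps its initial value 1, which
  turns the velocity at \<open>[i]\<close> into \<open>a s $ i\<close>. Level one thus recovers the
  control from the curve up to a null set.\<close>

lemma joins_level_one:
  assumes j: "joins N T g a \<xi>" and "1 \<le> N" and t: "t \<in> {0..T}"
  shows "\<xi> t [i] = primitive (\<lambda>s. a s $ i) t"
proof -
  have v0: "velocity N a \<xi> [] = (\<lambda>s. 0)"
    by (simp add: velocity_def U_Nil fun_eq_iff)
  have one: "\<xi> s [] = 1" if "s \<in> {0..T}" for s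
  proof -
    have "\<xi> s [] = 1 + primitive (velocity N a \<xi> []) s"
      using j that by (auto simp: joins_iff tensor_one_def)
    also have "\<dots> = 1"
      unfolding v0 by (simp add: primitive_def)
    finally show ?thesis .
  qed
  have "\<xi> t [i] = tensor_one [i] + primitive (velocity N a \<xi> [i]) t"
    using j t by (auto simp: joins_iff)
  also have "\<dots> = primitive (velocity N a \<xi> [i]) t"
    by (simp add: tensor_one_def)
  also have "\<dots> = primitive (\<lambda>s. a s $ i) t"
    unfolding primitive_def using t one
    by (intro Bochner_Integration.integral_cong) (auto simp: velocity_singleton[OF \<open>1 \<le> N\<close>])
  finally show ?thesis .
qed

lemma joins_zero_control:
  assumes j: "joins N T g a \<xi>" and "0 \<le> T" and "AE t in lebesgue_on {0..T}. a t = 0"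
  shows "g = tensor_one"
proof
  fix w
  have "primitive (velocity N a \<xi> w) T = 0"
    unfolding primitive_def
  proof (rule integral_eq_zero_AE)
    show "AE s in lebesgue_on {0..T}. velocity N a \<xi> w s = 0"
      using assms(3) by eventually_elim (simp add: velocity_def)
  qed
  then show "g w = tensor_one w"
    using j \<open>0 \<le> T\<close> by (auto simp: joins_iff)
qed

section \<open>Time change by arc length\<close>

lemma curve_length_eq_primitive: "curve_length T a = primitive (\<lambda>s. norm (a s)) T"
  by (simp add: curve_length_def primitive_def)

text \<open>Here \<open>primitive \<rho>\<close> is arc length divided by \<open>k\<close>, and the
  new curve is \<open>\<eta> \<circ> \<tau>\<close> for a right inverse \<open>\<tau>\<close> of it.
  Choosing \<open>k = 1\<close> turns length into time, while
  \<open>k = curve_length T b / T\<close> keeps the interval \<open>{0..T}\<close>.\<close>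

lemma constant_speed_reparametrization_borel:
  assumes j: "joins N T g b \<eta>" and b: "b \<in> borel_measurable borel" and "0 \<le> T" "0 < k"
  obtains c \<zeta> where "joins N (curve_length T b / k) g c \<zeta>" "constant_speed (curve_length T b / k) c k"
    "\<And>t. t \<in> {0..T} \<Longrightarrow> \<eta> t = \<zeta> (primitive (\<lambda>s. norm (b s)) t / k)"
proof -
  define \<rho> where "\<rho> s = norm (b s) / k" for s
  let ?\<sigma> = "primitive \<rho>"
  have L2b: "L2_on T b" using j by (simp add: joins_iff)
  have \<rho>: "integrable (lebesgue_on {0..T}) \<rho>" "\<And>t. 0 \<le> \<rho> t"
    using L2_on_integrable[OF L2b] \<open>0 < k\<close> by (auto simp: \<rho>_def[abs_def])
  have \<sigma>_eq: "?\<sigma> t = primitive (\<lambda>s. norm (b s)) t / k" for t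
    by (simp add: primitive_def \<rho>_def)
  define L where "L = ?\<sigma> T"
  have L: "L = curve_length T b / k"
    by (simp add: L_def \<sigma>_eq curve_length_eq_primitive)
  have mono: "mono_on {0..T} ?\<sigma>" using \<rho> by (intro primitive_mono)
  have cont: "continuous_on {0..T} ?\<sigma>" using \<rho> by (intro continuous_on_primitive)
  have \<sigma>_in: "?\<sigma> t \<in> {0..L}" if "t \<in> {0..T}" for t
    using mono_onD[OF mono, of 0 t] mono_onD[OF mono, of t T] that by (auto simp: L_def)
  obtain \<tau> where \<tau>: "mono \<tau>" "\<And>s. \<tau> s \<in> {0..T}" "\<And>s. s \<in> {0..L} \<Longrightarrow> ?\<sigma> (\<tau> s) = s"
    using ex_mono_right_inverse[OF mono cont \<open>0 \<le> T\<close>] unfolding L_def primitive_0 by metis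
  have \<tau>m: "\<tau> \<in> borel_measurable borel"
    using \<tau>(1) by (rule borel_measurable_mono)
  have \<tau>\<sigma>: "AE t in lebesgue_on {0..T}. \<rho> t \<noteq> 0 \<longrightarrow> \<tau> (?\<sigma> t) = t"
    using \<tau> \<rho> \<open>0 \<le> T\<close> by (intro AE_right_inverse_primitive) (auto simp: L_def)
  \<comment> \<open>Division by zero yields 0, so \<open>c\<close> vanishes where
    \<open>b (\<tau> s) = 0\<close>; elsewhere its norm is exactly \<open>k\<close>.\<close>
  define c where "c s = (1 / \<rho> (\<tau> s)) *\<^sub>R b (\<tau> s)" for s
  define \<zeta> where "\<zeta> s = \<eta> (\<tau> s)" for s
  have \<rho>m: "\<rho> \<in> borel_measurable borel"
    unfolding \<rho>_def using b by measurable
  have c_meas: "c \<in> borel_measurable borel"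
    unfolding c_def using measurable_compose[OF \<tau>m b] measurable_compose[OF \<tau>m \<rho>m] by measurable
  have c_norm: "norm (c s) = (if \<rho> (\<tau> s) = 0 then 0 else k)" for s
    using \<open>0 < k\<close> by (auto simp: c_def \<rho>_def)
  have \<eta>_cont: "continuous_on {0..T} (\<lambda>s. \<eta> s w)" for w
    using j by (simp add: joins_iff)
  have \<zeta>_meas: "(\<lambda>s. \<zeta> s w) \<in> borel_measurable borel" for w
  proof -
    \<comment> \<open>Continuity of \<open>\<eta>\<close> is known on \<open>{0..T}\<close> only.
      Clamping extends it to the line and changes nothing after composition with
      \<open>\<tau>\<close>, whose values lie in \<open>{0..T}\<close>.\<close>
    have "continuous_on UNIV (\<lambda>x. \<eta> (max 0 (min T x)) w)"
      by (rule continuous_on_compose2[OF \<eta>_cont]) (use \<open>0 \<le> T\<close> in \<open>auto intro!: continuous_intros\<close>)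
    then have "(\<lambda>x. \<eta> (max 0 (min T x)) w) \<in> borel_measurable borel"
      by (rule borel_measurable_continuous_onI)
    then have "(\<lambda>s. \<eta> (max 0 (min T (\<tau> s))) w) \<in> borel_measurable borel"
      by (rule measurable_compose[OF \<tau>m])
    moreover have "max 0 (min T (\<tau> s)) = \<tau> s" for s
      using \<tau>(2)[of s] by auto
    ultimately show ?thesis by (simp add: \<zeta>_def)
  qed
  have v_meas: "velocity N c \<zeta> w \<in> borel_measurable borel" for w
    by (intro borel_measurable_velocity c_meas \<zeta>_meas)
  \<comment> \<open>The chain rule in place of a differentiation of \<open>\<tau>\<close>: where
    \<open>\<rho>\<close> vanishes both sides are 0, and almost everywhere else
    \<open>\<tau>\<close> undoes the time change.\<close>
  have v_AE: "AE t in lebesgue_on {0..T}. velocity N b \<eta> w t = \<rho> t *\<^sub>R velocity N c \<zeta> w (?\<sigma> t)" for w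
    using \<tau>\<sigma>
  proof eventually_elim
    case (elim t)
    show ?case
    proof (cases "\<rho> t = 0")
      case True
      then have "b t = 0" using \<open>0 < k\<close> by (simp add: \<rho>_def)
      then show ?thesis using True by (simp add: velocity_def)
    next
      case False
      then show ?thesis using elim by (simp add: velocity_def c_def \<zeta>_def sum_distrib_left)
    qed
  qed
  \<comment> \<open>The right-hand side depends on \<open>t\<close> only through the primitive of
    \<open>\<rho>\<close>, so \<open>\<eta>\<close> is constant on its level sets. Hence the jumps
    of \<open>\<tau>\<close> leave no trace in \<open>\<zeta>\<close>.\<close>
  have \<eta>_eq: "\<eta> t w = tensor_one w + primitive (velocity N c \<zeta> w) (?\<sigma> t)" if t: "t \<in> {0..T}" for t w
  proof -
    have \<sigma>m: "?\<sigma> \<in> borel_measurable (lebesgue_on {0..T})"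
      by (rule continuous_imp_measurable_on_sets_lebesgue[OF cont]) simp
    have "\<eta> t w = tensor_one w + primitive (velocity N b \<eta> w) t"
      using j t by (auto simp: joins_iff)
    also have "primitive (velocity N b \<eta> w) t = primitive (\<lambda>t. \<rho> t *\<^sub>R velocity N c \<zeta> w (?\<sigma> t)) t"
    proof (rule primitive_cong_AE[OF _ _ v_AE])
      show "velocity N b \<eta> w \<in> borel_measurable (lebesgue_on {0..T})"
        using j by (auto simp: joins_iff L2_on_def)
      show "(\<lambda>t. \<rho> t *\<^sub>R velocity N c \<zeta> w (?\<sigma> t)) \<in> borel_measurable (lebesgue_on {0..T})"
        using \<rho>(1) measurable_compose[OF \<sigma>m v_meas] by (intro borel_measurable_scaleR) auto
    qed (use t in auto)
    also have "\<dots> = primitive (velocity N c \<zeta> w) (?\<sigma> t)"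
      using t \<rho> v_meas by (intro substitution_primitive[symmetric]) auto
    finally show ?thesis .
  qed
  have \<zeta>_eq: "\<zeta> s w = tensor_one w + primitive (velocity N c \<zeta> w) s" if "s \<in> {0..L}" for s w
    using \<eta>_eq[OF \<tau>(2)[of s], of w] \<tau>(3)[OF that] by (simp add: \<zeta>_def)
  have \<eta>\<zeta>: "\<eta> t = \<zeta> (?\<sigma> t)" if "t \<in> {0..T}" for t
    using \<eta>_eq[OF that] \<zeta>_eq[OF \<sigma>_in[OF that]] by auto
  have L2v: "L2_on L (velocity N c \<zeta> w)" for w
  proof -
    \<comment> \<open>The fields are bounded along the compact curve \<open>\<eta>\<close> and
      \<open>c\<close> is bounded by \<open>k\<close>, so the new velocity is bounded and hence
      square integrable.\<close>
    have "compact ((\<lambda>s. U N i (\<eta> s) w) ` {0..T})" for i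
      by (intro compact_continuous_image continuous_on_U \<eta>_cont compact_Icc)
    then have "\<exists>B. \<forall>s\<in>{0..T}. \<bar>U N i (\<eta> s) w\<bar> \<le> B" for i
      using compact_imp_bounded bounded_iff by (metis (no_types, lifting) image_eqI real_norm_def)
    then obtain B where B: "\<And>i s. s \<in> {0..T} \<Longrightarrow> \<bar>U N i (\<eta> s) w\<bar> \<le> B i"
      by metis
    have "norm (velocity N c \<zeta> w s) \<le> (\<Sum>i\<in>UNIV. k * B i)" for s
      unfolding velocity_def
    proof (rule sum_norm_le)
      fix i
      have "\<bar>c s $ i\<bar> \<le> k"
        using component_le_norm_cart[of "c s" i] c_norm[of s] \<open>0 < k\<close> by (auto split: if_splits)
      then show "norm (c s $ i * U N i (\<zeta> s) w) \<le> k * B i"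
        using B[OF \<tau>(2)[of s], of i] \<open>0 < k\<close> by (auto simp: \<zeta>_def abs_mult intro!: mult_mono)
    qed
    then show ?thesis
      by (intro L2_on_bounded measurable_borel_lebesgue_on v_meas)
  qed
  have "joins N L g c \<zeta>"
    unfolding joins_iff
  proof (intro conjI allI ballI)
    show "L2_on L c"
      by (rule L2_on_bounded[where K=k])
         (use c_norm \<open>0 < k\<close> in \<open>auto intro: measurable_borel_lebesgue_on c_meas\<close>)
    show "\<zeta> s \<in> signatures N" for s
      using j \<tau>(2)[of s] by (auto simp: joins_iff \<zeta>_def)
    \<comment> \<open>\<open>\<tau>\<close> need not map end points to end points; the values come
      from the factorization of \<open>\<eta>\<close> through the time change.\<close>
    show "\<zeta> 0 = tensor_one" "\<zeta> L = g"
      using \<eta>\<zeta>[of 0] \<eta>\<zeta>[of T] j \<open>0 \<le> T\<close> by (auto simp: joins_iff L_def)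
    show "L2_on L (velocity N c \<zeta> w)" for w by (rule L2v)
    show "\<zeta> t w = tensor_one w + primitive (velocity N c \<zeta> w) t" if "t \<in> {0..L}" for t w
      using that by (rule \<zeta>_eq)
    have "continuous_on {0..L} (\<lambda>s. tensor_one w + primitive (velocity N c \<zeta> w) s)" for w
      by (intro continuous_intros continuous_on_primitive L2_on_integrable L2v)
    then show "continuous_on {0..L} (\<lambda>s. \<zeta> s w)" for w
      by (rule continuous_on_eq) (simp add: \<zeta>_eq)
  qed
  moreover have "constant_speed L c k"
  proof -
    \<comment> \<open>The new speed is checked at the images of old times; the null-set form of the
      change of variables carries this over to almost all new times.\<close>
    have "AE t in lebesgue_on {0..T}. \<rho> t \<noteq> 0 \<longrightarrow> norm (c (?\<sigma> t)) = k"
      using \<tau>\<sigma> by eventually_elim (simp add: c_norm)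
    moreover have "{u. norm (c u) = k} \<in> sets borel"
      using c_meas by measurable
    ultimately show ?thesis
      unfolding constant_speed_def L_def
      using AE_lebesgue_on_primitive_iff[OF \<rho>(1) \<rho>(2) \<open>0 \<le> T\<close>, of "\<lambda>u. norm (c u) = k"] by simp
  qed
  ultimately show ?thesis
    using that \<eta>\<zeta> unfolding L \<sigma>_eq by blast
qed

lemma constant_speed_reparametrization:
  assumes j: "joins N T g b \<eta>" and "0 \<le> T" "0 < k"
  obtains c \<zeta> where "joins N (curve_length T b / k) g c \<zeta>" "constant_speed (curve_length T b / k) c k"
    "\<And>t. t \<in> {0..T} \<Longrightarrow> \<eta> t = \<zeta> (primitive (\<lambda>s. norm (b s)) t / k)"
proof -
  have b: "b \<in> borel_measurable (lebesgue_on {0..T})"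
    using j by (simp add: joins_iff L2_on_def)
  obtain b' where b': "b' \<in> borel_measurable borel" and ae: "AE t in lebesgue_on {0..T}. b t = b' t"
    by (rule ex_borel_version[OF b]) auto
  have b'M: "b' \<in> borel_measurable (lebesgue_on {0..T})"
    using b' by (rule measurable_borel_lebesgue_on)
  have eq: "primitive (\<lambda>s. norm (b' s)) t = primitive (\<lambda>s. norm (b s)) t" if "t \<le> T" for t
    by (rule primitive_cong_AE[OF _ _ _ that]) (use b b'M ae in \<open>auto elim: eventually_mono\<close>)
  have "joins N T g b' \<eta>"
    by (rule joins_cong_AE[OF j b'M ae])
  from constant_speed_reparametrization_borel[OF this b' \<open>0 \<le> T\<close> \<open>0 < k\<close>]
  obtain c \<zeta> where "joins N (curve_length T b' / k) g c \<zeta>" "constant_speed (curve_length T b' / k) c k"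
    "\<And>t. t \<in> {0..T} \<Longrightarrow> \<eta> t = \<zeta> (primitive (\<lambda>s. norm (b' s)) t / k)"
    by blast
  then show ?thesis
    by (intro that[of c \<zeta>]) (auto simp: curve_length_eq_primitive eq)
qed

subsection \<open>Energy, length and time\<close>

text \<open>Integrate the square of \<open>norm (a t) - m\<close>, where \<open>m\<close> is the
  mean speed. The result is \<open>(2 * T * energy T a - (curve_length T a)\<^sup>2) / T\<close>.
  Its nonnegativity is the Cauchy-Schwarz inequality, and if it is zero the speed equals
  \<open>m\<close> almost everywhere.\<close>

lemma
  assumes a: "L2_on T a" and "0 < T"
  shows curve_length_le_energy: "(curve_length T a)\<^sup>2 \<le> 2 * T * energy T a"
    and curve_length_eq_energyD:
      "(curve_length T a)\<^sup>2 = 2 * T * energy T a \<Longrightarrow> constant_speed T a (curve_length T a / T)"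
proof -
  let ?M = "lebesgue_on {0..T}"
  define m where "m = curve_length T a / T"
  have n: "integrable ?M (\<lambda>t. norm (a t))" "integrable ?M (\<lambda>t. (norm (a t))\<^sup>2)" "integrable ?M (\<lambda>t. m\<^sup>2)"
    using L2_on_integrable[OF a] a finite_measure.integrable_const[OF finite_measure_lebesgue_on_Icc]
    by (auto simp: L2_on_def)
  let ?h = "\<lambda>t. (norm (a t))\<^sup>2 - 2 * m * norm (a t) + m\<^sup>2"
  have h_sq: "?h t = (norm (a t) - m)\<^sup>2" for t
    by (simp add: power2_diff)
  have h: "integrable ?M ?h"
    using n by auto
  have "(LINT t|?M. ?h t) = 2 * energy T a - 2 * m * curve_length T a + T * m\<^sup>2"
    using n \<open>0 < T\<close> by (simp add: energy_def curve_length_def measure_lebesgue_on_Icc)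
  also have "\<dots> = (2 * T * energy T a - (curve_length T a)\<^sup>2) / T"
    using \<open>0 < T\<close> by (simp add: m_def field_simps power2_eq_square)
  finally have int: "(LINT t|?M. ?h t) = (2 * T * energy T a - (curve_length T a)\<^sup>2) / T" .
  have "0 \<le> (LINT t|?M. ?h t)"
    by (rule Bochner_Integration.integral_nonneg) (simp only: h_sq zero_le_power2)
  then show "(curve_length T a)\<^sup>2 \<le> 2 * T * energy T a"
    unfolding int using \<open>0 < T\<close> by (simp add: zero_le_divide_iff)
  assume "(curve_length T a)\<^sup>2 = 2 * T * energy T a"
  then have "(LINT t|?M. ?h t) = 0"
    unfolding int by simp
  then have "AE t in ?M. ?h t = 0"
    by (subst (asm) integral_nonneg_eq_0_iff_AE[OF h]) (auto intro!: AE_I2 simp only: h_sq zero_le_power2)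
  then show "constant_speed T a (curve_length T a / T)"
    unfolding constant_speed_def m_def[symmetric] by eventually_elim (simp only: h_sq, simp)
qed

lemma
  assumes a: "a \<in> borel_measurable (lebesgue_on {0..T})" and c: "constant_speed T a c" and "0 \<le> T"
  shows curve_length_constant_speed: "curve_length T a = T * c"
    and energy_constant_speed: "energy T a = T * c\<^sup>2 / 2"
proof -
  have "curve_length T a = (LINT t|lebesgue_on {0..T}. c)"
    unfolding curve_length_def
    by (rule integral_cong_AE) (use a c in \<open>auto simp: constant_speed_def elim: eventually_mono\<close>)
  then show "curve_length T a = T * c"
    using \<open>0 \<le> T\<close> by (simp only: integral_lebesgue_on_Icc_const)
  have "(LINT t|lebesgue_on {0..T}. (norm (a t))\<^sup>2) = (LINT t|lebesgue_on {0..T}. c\<^sup>2)"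
    by (rule integral_cong_AE) (use a c in \<open>auto simp: constant_speed_def elim: eventually_mono\<close>)
  then show "energy T a = T * c\<^sup>2 / 2"
    unfolding energy_def using \<open>0 \<le> T\<close> by (simp only: integral_lebesgue_on_Icc_const)
qed

lemma curve_length_pos:
  assumes j: "joins N T g a \<xi>" and "0 \<le> T" "g \<noteq> tensor_one"
  shows "0 < curve_length T a"
proof -
  have n: "integrable (lebesgue_on {0..T}) (\<lambda>t. norm (a t))"
    using j L2_on_integrable by (auto simp: joins_iff)
  have "0 \<le> curve_length T a"
    by (simp add: curve_length_def)
  moreover have "curve_length T a \<noteq> 0"
  proof
    assume "curve_length T a = 0"
    then have "AE t in lebesgue_on {0..T}. norm (a t) = 0"
      unfolding curve_length_def by (subst (asm) integral_nonneg_eq_0_iff_AE[OF n]) auto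
    then show False
      using joins_zero_control[OF j \<open>0 \<le> T\<close>] \<open>g \<noteq> tensor_one\<close> by simp
  qed
  ultimately show ?thesis by simp
qed

lemma joins_imp_pos_time:
  assumes "joins N T g a \<xi>" "0 \<le> T" "g \<noteq> tensor_one"
  shows "0 < T"
  using assms by (cases "T = 0") (auto simp: joins_def)

text \<open>This makes the change of variables for primitives available for smooth time changes. The
  density is the derivative of \<open>\<psi>\<close>: monotonicity makes it nonnegative at interior
  points, and continuity extends the sign to the end points.\<close>

lemma smooth_on_interval_primitive:
  assumes "smooth_on_interval T \<psi>" "mono_on {0..T} \<psi>" "0 < T" "\<psi> 0 = 0"
  obtains \<rho> where "integrable (lebesgue_on {0..T}) \<rho>" "\<And>t. t \<in> {0..T} \<Longrightarrow> 0 \<le> \<rho> t"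
    "\<And>t. t \<in> {0..T} \<Longrightarrow> \<psi> t = primitive \<rho> t"
proof -
  obtain D where D0: "D 0 = \<psi>"
    and D: "\<And>k t. t \<in> {0..T} \<Longrightarrow> (D k has_real_derivative D (Suc k) t) (at t within {0..T})"
    using assms(1) unfolding smooth_on_interval_def by blast
  define \<rho> where "\<rho> = D 1"
  have der: "(\<psi> has_real_derivative \<rho> t) (at t within {0..T})" if "t \<in> {0..T}" for t
    using D[OF that, of 0] by (simp add: \<rho>_def D0)
  have cont: "continuous_on {0..T} \<rho>"
    unfolding continuous_on_eq_continuous_within \<rho>_def
    using DERIV_continuous[OF D[of _ 1]] by blast
  have int: "integrable (lebesgue_on {0..T}) \<rho>"
    using cont by (rule continuous_imp_integrable_real)
  have interior: "0 \<le> \<rho> t" if "t \<in> {0<..<T}" for t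
  proof (rule mono_on_imp_deriv_nonneg[OF assms(2)])
    show "t \<in> interior {0..T}" using that by simp
    then show "(\<psi> has_real_derivative \<rho> t) (at t)"
      using der[of t] at_within_interior[of t "{0..T}"] that by auto
  qed
  have nonneg: "0 \<le> \<rho> t" if "t \<in> {0..T}" for t
    using continuous_ge_on_closure[of "{0<..<T}" \<rho> t 0] that cont interior \<open>0 < T\<close>
    by (simp add: closure_greaterThanLessThan)
  have "\<psi> t = primitive \<rho> t" if "t \<in> {0..T}" for t
  proof -
    have "(\<rho> has_integral \<psi> t - \<psi> 0) {0..t}"
    proof (rule fundamental_theorem_of_calculus)
      fix s assume "s \<in> {0..t}"
      then show "(\<psi> has_vector_derivative \<rho> s) (at s within {0..t})"
        using der[of s] that
        by (auto simp: has_real_derivative_iff_has_vector_derivative[symmetric] intro: DERIV_subset)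
    qed (use that in simp)
    then show ?thesis
      using primitive_eq_integral[OF int] that \<open>\<psi> 0 = 0\<close> by (simp add: integral_unique)
  qed
  then show ?thesis
    using that int nonneg by blast
qed

text \<open>Uniqueness of densities for the level-one components shows \<open>a = (b \<circ> \<psi>) \<psi>'\<close> almost
  everywhere.\<close>

lemma curve_length_reparametrization:
  assumes j\<xi>: "joins N T g a \<xi>" and j\<eta>: "joins N S g b \<eta>" and "1 \<le> N" and "0 < T"
    and unit: "constant_speed S b 1" and rep: "reparametrization_of T \<xi> S \<eta>"
  shows "curve_length T a = S"
proof -
  let ?M = "lebesgue_on {0..T}"
  obtain \<psi> where \<psi>: "smooth_on_interval T \<psi>" "mono_on {0..T} \<psi>" "\<psi> 0 = 0" "\<psi> T = S"
    "\<psi> ` {0..T} = {0..S}" "\<And>t. t \<in> {0..T} \<Longrightarrow> \<xi> t = \<eta> (\<psi> t)"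
    using rep by (auto simp: reparametrization_of_def)
  obtain \<rho> where \<rho>: "integrable ?M \<rho>" "\<And>t. t \<in> {0..T} \<Longrightarrow> 0 \<le> \<rho> t"
    and \<psi>\<rho>: "\<And>t. t \<in> {0..T} \<Longrightarrow> \<psi> t = primitive \<rho> t"
    using smooth_on_interval_primitive[OF \<psi>(1,2) \<open>0 < T\<close> \<psi>(3)] by metis
  have S: "S = primitive \<rho> T" using \<psi>(4) \<psi>\<rho>[of T] \<open>0 < T\<close> by simp
  have bm: "b \<in> borel_measurable (lebesgue_on {0..S})"
    using j\<eta> by (simp add: joins_iff L2_on_def)
  \<comment> \<open>A Borel version of \<open>b\<close> stays measurable after composition with the
    time change.\<close>
  obtain b' where b': "b' \<in> borel_measurable borel" and ae: "AE t in lebesgue_on {0..S}. b t = b' t"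
    by (rule ex_borel_version[OF bm]) auto
  have b'i: "(\<lambda>s. b' s $ i) \<in> borel_measurable borel" for i
    using measurable_compose[OF b', of "\<lambda>x. x $ i" borel]
    by (simp add: borel_measurable_continuous_onI continuous_intros)
  have "AE u in lebesgue_on {0..S}. norm (b' u) = 1"
    using unit ae unfolding constant_speed_def by eventually_elim simp
  moreover have "{u. norm (b' u) = 1} \<in> sets borel" using b' by measurable
  ultimately have unit': "AE t in ?M. \<rho> t \<noteq> 0 \<longrightarrow> norm (b' (primitive \<rho> t)) = 1"
    unfolding S using AE_lebesgue_on_primitive_iff[OF \<rho>, of "\<lambda>u. norm (b' u) = 1"] \<open>0 < T\<close> by simp
  have \<sigma>m: "primitive \<rho> \<in> borel_measurable ?M"
    by (rule continuous_imp_measurable_on_sets_lebesgue[OF continuous_on_primitive[OF \<rho>(1)]]) simp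
  have comp: "AE t in ?M. a t $ i = \<rho> t * b' (primitive \<rho> t) $ i" for i
  proof -
    let ?f = "\<lambda>t. a t $ i" and ?g = "\<lambda>t. \<rho> t *\<^sub>R b' (primitive \<rho> t) $ i"
    have ai: "integrable ?M ?f"
      using integrable_inner_left[OF L2_on_integrable[of T a], of "axis i 1"] j\<xi>
      by (simp add: joins_iff inner_axis)
    have gm: "?g \<in> borel_measurable ?M"
      using \<rho>(1) measurable_compose[OF \<sigma>m b'i] by (intro borel_measurable_scaleR) auto
    have gi: "integrable ?M ?g"
    proof (rule Bochner_Integration.integrable_bound[OF \<rho>(1) gm])
      show "AE t in ?M. norm (?g t) \<le> norm (\<rho> t)"
        using unit'
      proof eventually_elim
        case (elim t)
        then show ?case
          using component_le_norm_cart[of "b' (primitive \<rho> t)" i]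
          by (cases "\<rho> t = 0") (auto simp: abs_mult intro: mult_left_le)
      qed
    qed
    \<comment> \<open>Both primitives are the level-one coordinate \<open>\<xi> t [i]\<close>, the
      second one after writing \<open>\<xi>\<close> as \<open>\<eta> \<circ> \<psi>\<close> and
      substituting.\<close>
    have eq: "primitive ?f t = primitive ?g t" if t: "t \<in> {0..T}" for t
    proof -
      have \<psi>t: "\<psi> t \<in> {0..S}" using \<psi>(5) t by blast
      have "primitive ?f t = primitive (\<lambda>s. b s $ i) (\<psi> t)"
        using joins_level_one[OF j\<xi> \<open>1 \<le> N\<close> t] joins_level_one[OF j\<eta> \<open>1 \<le> N\<close> \<psi>t] \<psi>(6)[OF t] by simp
      also have "\<dots> = primitive (\<lambda>s. b' s $ i) (\<psi> t)"
      proof (rule primitive_cong_AE)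
        show "(\<lambda>s. b s $ i) \<in> borel_measurable (lebesgue_on {0..S})"
          using measurable_compose[OF bm, of "\<lambda>x. x $ i" borel]
          by (simp add: borel_measurable_continuous_onI continuous_intros)
        show "AE t in lebesgue_on {0..S}. b t $ i = b' t $ i"
          using ae by eventually_elim simp
      qed (use \<psi>t b'i in \<open>auto intro: measurable_borel_lebesgue_on\<close>)
      also have "\<dots> = primitive ?g t"
        unfolding \<psi>\<rho>[OF t] using \<rho> t b'i by (intro substitution_primitive)
      finally show ?thesis .
    qed
    have "AE t in ?M. ?f t - ?g t = 0"
    proof (rule AE_zero_if_primitive_zero)
      show "integrable ?M (\<lambda>t. ?f t - ?g t)" using ai gi by auto
      fix t assume t: "t \<in> {0..T}"
      have "integrable (lebesgue_on {0..t}) ?f" "integrable (lebesgue_on {0..t}) ?g"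
        using t integrable_lebesgue_on_subset[OF ai, of "{0..t}"]
          integrable_lebesgue_on_subset[OF gi, of "{0..t}"] by auto
      then have "primitive (\<lambda>t. ?f t - ?g t) t = primitive ?f t - primitive ?g t"
        unfolding primitive_def by (rule Bochner_Integration.integral_diff)
      then show "primitive (\<lambda>t. ?f t - ?g t) t = 0"
        using eq[OF t] by simp
    qed
    then show ?thesis by eventually_elim simp
  qed
  have "AE t in ?M. \<forall>i\<in>UNIV. a t $ i = \<rho> t * b' (primitive \<rho> t) $ i"
    by (rule AE_finite_allI) (auto intro: comp)
  moreover have "AE t in ?M. 0 \<le> \<rho> t" using \<rho>(2) by (intro AE_I2) simp
  \<comment> \<open>Where \<open>\<rho>\<close> vanishes so does \<open>a\<close>; elsewhere
    \<open>a t\<close> is \<open>\<rho> t\<close> times a unit vector. The length is therefore the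
    total increment of \<open>\<psi>\<close>, which is \<open>S\<close>.\<close>
  ultimately have "AE t in ?M. norm (a t) = \<rho> t"
    using unit'
  proof eventually_elim
    case (elim t)
    then have "a t = \<rho> t *\<^sub>R b' (primitive \<rho> t)" by (simp add: vec_eq_iff)
    then show ?case using elim by (cases "\<rho> t = 0") auto
  qed
  then have "curve_length T a = (LINT t|?M. \<rho> t)"
    unfolding curve_length_def
    by (intro integral_cong_AE) (use j\<xi> \<rho> in \<open>auto simp: joins_iff L2_on_def\<close>)
  then show ?thesis by (simp add: S primitive_def)
qed

section \<open>Equivalence of the minimization problems\<close>

lemma smooth_on_interval_linear: "smooth_on_interval T (\<lambda>t. c * t)"
  unfolding smooth_on_interval_def
proof (intro exI[of _ "\<lambda>k t. if k = 0 then c * t else if k = 1 then c else 0"] conjI allI ballI)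
  fix k :: nat and t
  show "((\<lambda>t. if k = 0 then c * t else if k = 1 then c else 0) has_real_derivative
      (if Suc k = 0 then c * t else if Suc k = 1 then c else 0)) (at t within {0..T})"
    by (cases "k = 0") (auto intro!: derivative_eq_intros)
qed simp

text \<open>Rerunning a competitor \<open>b\<close> over \<open>{0..T}\<close> at constant speed
  gives a curve whose energy times \<open>2 * T\<close> is the squared length of \<open>b\<close>.
  An energy minimizer thus satisfies \<open>(curve_length T a)\<^sup>2 \<le> 2 * T * energy T a
  \<le> (curve_length T b)\<^sup>2\<close>. Conversely, constant speed turns the first inequality
  into an equality, and Cauchy-Schwarz for \<open>b\<close> finishes the comparison.\<close>

lemma minimizes_energy_iff_length:
  assumes j: "joins N T g a \<xi>" and "0 < T" and g: "g \<noteq> tensor_one"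
  shows "minimizes_energy N T g a \<longleftrightarrow>
    minimizes_length N T g a \<xi> \<and> (\<exists>c>0. constant_speed T a c)"
proof
  assume E: "minimizes_energy N T g a"
  have L2: "L2_on T a" using j by (simp add: joins_iff)
  have le: "(curve_length T a)\<^sup>2 \<le> 2 * T * energy T a" "2 * T * energy T a \<le> (curve_length T b)\<^sup>2"
    if b: "joins N T g b \<eta>" for b \<eta>
  proof -
    let ?L = "curve_length T b"
    have L: "0 < ?L" using curve_length_pos[OF b _ g] \<open>0 < T\<close> by simp
    \<comment> \<open>The speed \<open>?L / T\<close> is the one for which the reparametrized
      competitor again takes time \<open>T\<close>.\<close>
    then have T: "?L / (?L / T) = T" by simp
    obtain c \<zeta> where c: "joins N T g c \<zeta>" "constant_speed T c (?L / T)"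
      using constant_speed_reparametrization[OF b, of "?L / T", unfolded T]
        less_imp_le[OF \<open>0 < T\<close>] divide_pos_pos[OF L \<open>0 < T\<close>] by metis
    have "energy T c = T * (?L / T)\<^sup>2 / 2"
      by (rule energy_constant_speed) (use c \<open>0 < T\<close> in \<open>auto simp: joins_iff L2_on_def\<close>)
    then have "2 * T * energy T c = ?L\<^sup>2"
      using \<open>0 < T\<close> by (simp add: power2_eq_square)
    moreover have "energy T a \<le> energy T c"
      using E c by (auto simp: minimizes_energy_def)
    then have "2 * T * energy T a \<le> 2 * T * energy T c"
      using \<open>0 < T\<close> by simp
    ultimately show "2 * T * energy T a \<le> ?L\<^sup>2" by simp
    show "(curve_length T a)\<^sup>2 \<le> 2 * T * energy T a"
      by (rule curve_length_le_energy[OF L2 \<open>0 < T\<close>])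
  qed
  have "minimizes_length N T g a \<xi>"
    unfolding minimizes_length_def
  proof (intro conjI allI impI j)
    fix b \<eta> assume b: "joins N T g b \<eta>"
    have "0 \<le> curve_length T b" by (simp add: curve_length_def)
    with order_trans[OF le[OF b]] show "curve_length T a \<le> curve_length T b"
      by (rule power2_le_imp_le)
  qed
  \<comment> \<open>With \<open>a\<close> itself as competitor the two bounds collapse to the
    equality case of Cauchy-Schwarz.\<close>
  moreover have "constant_speed T a (curve_length T a / T)"
    by (rule curve_length_eq_energyD[OF L2 \<open>0 < T\<close>]) (use le[OF j] in simp)
  ultimately show "minimizes_length N T g a \<xi> \<and> (\<exists>c>0. constant_speed T a c)"
    using curve_length_pos[OF j _ g] \<open>0 < T\<close> by (auto intro!: exI[of _ "curve_length T a / T"])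
next
  assume "minimizes_length N T g a \<xi> \<and> (\<exists>c>0. constant_speed T a c)"
  then obtain c where m: "minimizes_length N T g a \<xi>" and c: "constant_speed T a c" by auto
  have am: "a \<in> borel_measurable (lebesgue_on {0..T})" using j by (simp add: joins_iff L2_on_def)
  have E: "2 * T * energy T a = (curve_length T a)\<^sup>2"
    unfolding curve_length_constant_speed[OF am c less_imp_le[OF \<open>0 < T\<close>]]
      energy_constant_speed[OF am c less_imp_le[OF \<open>0 < T\<close>]]
    by (simp add: power2_eq_square)
  show "minimizes_energy N T g a"
    unfolding minimizes_energy_def
  proof (intro conjI allI impI exI[of _ \<xi>] j)
    fix b \<eta> assume b: "joins N T g b \<eta>"
    have "0 \<le> curve_length T a" by (simp add: curve_length_def)
    then have "(curve_length T a)\<^sup>2 \<le> (curve_length T b)\<^sup>2"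
      using m b by (auto simp: minimizes_length_def intro!: power_mono)
    also have "\<dots> \<le> 2 * T * energy T b"
      using b \<open>0 < T\<close> by (intro curve_length_le_energy) (auto simp: joins_iff)
    finally have "2 * T * energy T a \<le> 2 * T * energy T b" unfolding E .
    then show "energy T a \<le> energy T b" using \<open>0 < T\<close> by simp
  qed
qed

text \<open>The length of \<open>\<xi>\<close> is the minimal time \<open>S\<close>. Any competitor,
  run at unit speed, takes a time equal to its length, so this length is at least
  \<open>S\<close>.\<close>

lemma reparametrizes_time_minimizer_imp_minimizes_length:
  assumes j: "joins N T g a \<xi>" and "1 \<le> N" "0 < T" and g: "g \<noteq> tensor_one"
    and rep: "reparametrizes_time_minimizer N T g \<xi>"
  shows "minimizes_length N T g a \<xi>"
proof -
  obtain S b \<eta> where t: "minimizes_time N g S b \<eta>" and r: "reparametrization_of T \<xi> S \<eta>"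
    using rep by (auto simp: reparametrizes_time_minimizer_def)
  have S: "curve_length T a = S"
    using t r j assms by (intro curve_length_reparametrization) (auto simp: minimizes_time_def)
  show ?thesis
    unfolding minimizes_length_def
  proof (intro conjI allI impI j)
    fix b' \<eta>' assume b': "joins N T g b' \<eta>'"
    obtain c \<zeta> where "joins N (curve_length T b') g c \<zeta>" "constant_speed (curve_length T b') c 1"
      using constant_speed_reparametrization[OF b' less_imp_le[OF \<open>0 < T\<close>] zero_less_one]
      by (metis div_by_1)
    moreover have "0 \<le> curve_length T b'" by (simp add: curve_length_def)
    ultimately show "curve_length T a \<le> curve_length T b'"
      using t unfolding S minimizes_time_def by blast
  qed
qed

text \<open>At constant speed \<open>c\<close> the arc length at time \<open>t\<close> is
  \<open>c * t\<close>, so the passage to unit speed is a linear, hence smooth, time change. A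
  faster unit-speed curve would, rerun over \<open>{0..T}\<close>, be a shorter competitor for the
  length.\<close>

lemma minimizes_length_imp_reparametrizes_time_minimizer:
  assumes m: "minimizes_length N T g a \<xi>" and "0 < T" and g: "g \<noteq> tensor_one"
    and c: "constant_speed T a c" and "0 < c"
  shows "reparametrizes_time_minimizer N T g \<xi>"
proof -
  have j: "joins N T g a \<xi>" using m by (simp add: minimizes_length_def)
  have am: "a \<in> borel_measurable (lebesgue_on {0..T})" using j by (simp add: joins_iff L2_on_def)
  have len: "curve_length T a = c * T"
    using curve_length_constant_speed[OF am c] \<open>0 < T\<close> by simp
  obtain b \<eta> where b: "joins N (c * T) g b \<eta>" "constant_speed (c * T) b 1"
    and \<xi>\<eta>: "\<And>t. t \<in> {0..T} \<Longrightarrow> \<xi> t = \<eta> (primitive (\<lambda>s. norm (a s)) t)"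
    using constant_speed_reparametrization[OF j, of 1] \<open>0 < T\<close> by (auto simp: len)
  have \<xi>\<eta>': "\<xi> t = \<eta> (c * t)" if t: "t \<in> {0..T}" for t
  proof -
    have "primitive (\<lambda>s. norm (a s)) t = primitive (\<lambda>s. c) t"
      by (rule primitive_cong_AE[of _ T]) (use am c t in \<open>auto simp: constant_speed_def\<close>)
    also have "\<dots> = c * t"
      using t by (simp add: primitive_def measure_lebesgue_on_Icc)
    finally show ?thesis using \<xi>\<eta>[OF t] by simp
  qed
  have "minimizes_time N g (c * T) b \<eta>"
    unfolding minimizes_time_def
  proof (intro conjI allI impI b)
    show "0 \<le> c * T" using \<open>0 < c\<close> \<open>0 < T\<close> by simp
    fix S b' \<eta>' assume S: "0 \<le> S \<and> joins N S g b' \<eta>' \<and> constant_speed S b' 1"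
    then have "0 < S" using joins_imp_pos_time g by blast
    have "curve_length S b' = S * 1"
      using S by (intro curve_length_constant_speed) (auto simp: joins_iff L2_on_def)
    \<comment> \<open>A unit-speed curve on \<open>{0..S}\<close> has length \<open>S\<close>, so
      the speed \<open>S / T\<close> brings it back to duration \<open>T\<close>.\<close>
    then have S': "curve_length S b' / (S / T) = T"
      using \<open>0 < S\<close> by simp
    obtain c' \<zeta> where c': "joins N T g c' \<zeta>" "constant_speed T c' (S / T)"
      using constant_speed_reparametrization[of N S g b' \<eta>' "S / T", unfolded S']
        S divide_pos_pos[OF \<open>0 < S\<close> \<open>0 < T\<close>] by metis
    have "curve_length T c' = T * (S / T)"
      using c' \<open>0 < T\<close> by (intro curve_length_constant_speed) (auto simp: joins_iff L2_on_def)
    moreover have "curve_length T a \<le> curve_length T c'"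
      using m c' by (auto simp: minimizes_length_def)
    ultimately show "c * T \<le> S" using len \<open>0 < T\<close> by simp
  qed
  moreover have "reparametrization_of T \<xi> (c * T) \<eta>"
    unfolding reparametrization_of_def
  proof (intro exI[of _ "\<lambda>t. c * t"] conjI smooth_on_interval_linear)
    show "mono_on {0..T} (\<lambda>t. c * t)" using \<open>0 < c\<close> by (auto simp: mono_on_def)
    show "(\<lambda>t. c * t) ` {0..T} = {0..c * T}"
      using \<open>0 < c\<close> \<open>0 < T\<close> image_mult_atLeastAtMost[of c 0 T] by (simp add: mult.commute)
  qed (use \<xi>\<eta>' in auto)
  ultimately show ?thesis
    unfolding reparametrizes_time_minimizer_def by blast
qed

text \<open>A smooth monotone time change may vary the speed, so condition (3) is paired with
  constant speed in the equivalence and by itself yields minimal length. For the unit as end point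
  the constant curve has energy and speed zero, which is incompatible with \<open>c > 0\<close> in
  (2).\<close>

theorem theorem3p1:
  fixes N :: nat and T :: real and gbar :: "'d::finite tensor"
    and a :: "real \<Rightarrow> real ^ 'd" and \<xi> :: "real \<Rightarrow> 'd tensor"
  assumes "1 \<le> N"
    and "gbar \<in> signatures N"
    and "gbar \<noteq> tensor_one"
    and "0 < T"
    and "admissible_curve N T a \<xi>"
    and "\<xi> 0 = tensor_one"
    and "\<xi> T = gbar"
  shows "(minimizes_energy N T gbar a \<longleftrightarrow>
            minimizes_length N T gbar a \<xi> \<and> (\<exists>c>0. constant_speed T a c)) \<and>
         (minimizes_energy N T gbar a \<longleftrightarrow>
            reparametrizes_time_minimizer N T gbar \<xi> \<and> (\<exists>c. constant_speed T a c)) \<and>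
         (reparametrizes_time_minimizer N T gbar \<xi> \<longrightarrow> minimizes_length N T gbar a \<xi>)"
proof -
  have j: "joins N T gbar a \<xi>" using assms by (simp add: joins_def)
  have am: "a \<in> borel_measurable (lebesgue_on {0..T})" using j by (simp add: joins_iff L2_on_def)
  \<comment> \<open>The length is \<open>T * c\<close> and is positive because the end points
    differ, so every constant speed of \<open>a\<close> is positive. This matches the unsigned
    constant in the third condition with \<open>c > 0\<close> in the second.\<close>
  have pos: "0 < c" if "constant_speed T a c" for c
    using curve_length_constant_speed[OF am that] curve_length_pos[OF j] assms
    by (simp add: zero_less_mult_iff)
  note energy_length = minimizes_energy_iff_length[OF j \<open>0 < T\<close> \<open>gbar \<noteq> tensor_one\<close>]
  note time_length = reparametrizes_time_minimizer_imp_minimizes_length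
    [OF j \<open>1 \<le> N\<close> \<open>0 < T\<close> \<open>gbar \<noteq> tensor_one\<close>]
  note length_time = minimizes_length_imp_reparametrizes_time_minimizer
    [OF _ \<open>0 < T\<close> \<open>gbar \<noteq> tensor_one\<close>]
  show ?thesis
    using energy_length time_length length_time pos by blast
qed

end
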